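(* The following problem can be decided in polynomial time: given a parameterized program $P$ with the trivial synchronization alphabet (no synchronization) and thread template $G$, a (not necessarily symmetric) commutativity relation $I\subseteq\Sigma(G)^2$, and a sync-point instrumentation $G'$ of $P$, decide whether $G'$ is sound with respect to $I$.
   Context: Sequences. $X^*$ is the set of finite sequences over $X$. $\tau|_Z$ is obtained from $\tau$ by deleting all letters not in $Z$ (elementwise on languages). $\mathsf{Act}$ is a fixed infinite set of actions. For a set $A$, $A_{\mathsf{idx}}=A\times\mathbb N$; its elements are written $\langle a:i\rangle$ (action $a$ executed by thread $i$). For $\tau\in A_{\mathsf{idx}}^*$, $\lfloor\tau\rfloor_i\in A^*$ is the sequence of actions of thread $i$ in $\tau$. Programs. A control flow graph $G=(\mathbb L,\Delta,\ell_{\mathsf{init}},\ell_{\mathsf{exit}})$ over a set of labels $A$ has finitely many locations $\mathbb L$, a finite transition relation $\Delta\subseteq\mathbb L\times A\times\mathbb L$, and $\ell_{\mathsf{init}}\ne\ell_{\mathsf{exit}}$. Every location is reachable from $\ell_{\mathsf{init}}$, $\ell_{\mathsf{exit}}$ is reachable from every location, and each $a\in\mathsf{Act}$ labels at most one edge. $\Sigma(G)$ is the set of labels occurring in $G$; $\mathcal T(G)$ is the set of label sequences of paths from $\ell_{\mathsf{init}}$ to $\ell_{\mathsf{exit}}$. A parameterized program $P$ with the trivial synchronization alphabet is given by a control flow graph $G$ over $\mathsf{Act}$ (the thread template); its interleavings are $\mathcal L(P)=\{\tau\in\mathsf{Act}_{\mathsf{idx}}^*\mid\forall i\in\mathbb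 N.\ \lfloor\tau\rfloor_i\in\mathcal T(G)\cup\{\varepsilon\}\}$. Reductions. $\sqsubseteq_I$ is the smallest reflexive-transitive relation on $\mathsf{Act}_{\mathsf{idx}}^*$ with $\rho\langle a:i\rangle\langle b:j\rangle\sigma\sqsubseteq_I\rho\langle b:j\rangle\langle a:i\rangle\sigma$ for all $\rho,\sigma$, $(a,b)\in I$, $i\ne j$. $L_1$ is a Mazurkiewicz reduction of $L_2$ (up to $I$) if $L_1\subseteq L_2$ and every $\tau\in L_2$ has some $\tau'\in L_1$ with $\tau\sqsubseteq_I\tau'$. Sync-points. Let $\bullet\notin\mathsf{Act}$. For finite $T=\{t_1,\dots,t_n\}\subseteq\mathbb N$, $\langle\bullet:T\rangle$ denotes $\langle\bullet:t_1\rangle\dots\langle\bullet:t_n\rangle$. Define $\mathsf{sync}_{\bullet,\emptyset}(\tau)$ iff $\tau=\varepsilon$, and for finite nonempty $T$: $\mathsf{sync}_{\bullet,T}(\tau)$ iff $\tau=\tau_1\tau_2$ with $\tau_1\in\big((\mathsf{Act}\times T)^*+\langle\bullet:T\rangle\big)^*$ and $\mathsf{sync}_{\bullet,T'}(\tau_2)$ for some $T'\subsetneq T$. $\mathsf{sync}_\bullet(\tau)$ iff $\mathsf{sync}_{\bullet,T}(\tau)$ for some finite $T\subseteq\mathbb N$. A sync-point instrumentation of $P$ is a control flow graph $G'$ over $\mathsf{Act}\cup\{\bullet\}$ with $\mathcal T(G)=\mathcal T(G')|_{\mathsf{Act}}$ such that for $\tau_1,\tau_2\in\mathcal T(G')$,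 $\tau_1|_{\mathsf{Act}}=\tau_2|_{\mathsf{Act}}$ implies $\tau_1=\tau_2$. The instrumented program $P\lhd_\bullet G'$ has interleavings $\mathcal L(P\lhd_\bullet G')=\{\hat\tau|_{\mathsf{Act}_{\mathsf{idx}}}\mid\hat\tau\in(\mathsf{Act}\cup\{\bullet\})_{\mathsf{idx}}^*,\ \mathsf{sync}_\bullet(\hat\tau),\ \forall i.\ \lfloor\hat\tau\rfloor_i\in\mathcal T(G')\cup\{\varepsilon\}\}$. $G'$ is sound w.r.t. $I$ if $\mathcal L(P\lhd_\bullet G')$ is a Mazurkiewicz reduction up to $I$ of $\mathcal L(P)$. *)

theory Defs
  imports "HOL-Computational_Algebra.Polynomial"
begin

section \<open>Sequences and indexed actions\<close>

text \<open>The set of actions is \<^term>\<open>range Action\<close>; it is infinite whenever the type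
  of action names is. \<open>Bullet\<close> is the additional letter that marks sync-points.\<close>

datatype 'a label = Action 'a | Bullet

definition Act :: "'a label set" where
  "Act = range Action"

type_synonym 'b idx = "'b \<times> nat"

definition Idx :: "'b set \<Rightarrow> 'b idx set" where
  "Idx A = A \<times> UNIV"

definition restrict_word :: "'b set \<Rightarrow> 'b list \<Rightarrow> 'b list" where
  "restrict_word Z \<tau> = filter (\<lambda>x. x \<in> Z) \<tau>"

definition thread_word :: "nat \<Rightarrow> 'b idx list \<Rightarrow> 'b list" where
  "thread_word i \<tau> = map fst (filter (\<lambda>x. snd x = i) \<tau>)"

definition kstar :: "'b list set \<Rightarrow> 'b list set" where
  "kstar L = concat ` lists L"


section \<open>Programs\<close>

record ('l, 'b) cfg =
  locs :: "'l set"
  trans :: "('l \<times> 'b \<times> 'l) set"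
  init :: 'l
  exit :: 'l

inductive path :: "('l, 'b) cfg \<Rightarrow> 'l \<Rightarrow> 'b list \<Rightarrow> 'l \<Rightarrow> bool" for G where
  path_Nil: "l \<in> locs G \<Longrightarrow> path G l [] l"
| path_Cons: "(l, a, l') \<in> trans G \<Longrightarrow> path G l' w l'' \<Longrightarrow> path G l (a # w) l''"

text \<open>Only proper actions are required to label at most one edge; \<open>Bullet\<close> may
  label several edges.\<close>

definition control_flow_graph :: "'a label set \<Rightarrow> ('l, 'a label) cfg \<Rightarrow> bool" where
  "control_flow_graph A G \<longleftrightarrow>
     finite (locs G) \<and>
     finite (trans G) \<and> trans G \<subseteq> locs G \<times> A \<times> locs G \<and>
     init G \<in> locs G \<and> exit G \<in> locs G \<and> init G \<noteq> exit G \<and>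
     (\<forall>l\<in>locs G. \<exists>w. path G (init G) w l) \<and>
     (\<forall>l\<in>locs G. \<exists>w. path G l w (exit G)) \<and>
     (\<forall>a\<in>Act. \<forall>l1 l1' l2 l2'. (l1, a, l1') \<in> trans G \<longrightarrow> (l2, a, l2') \<in> trans G \<longrightarrow>
        l1 = l2 \<and> l1' = l2')"

definition labels :: "('l, 'b) cfg \<Rightarrow> 'b set" where
  "labels G = {a. \<exists>l l'. (l, a, l') \<in> trans G}"

definition traces :: "('l, 'b) cfg \<Rightarrow> 'b list set" where
  "traces G = {w. path G (init G) w (exit G)}"

text \<open>A parameterized program without synchronization is given by its thread template.\<close>

definition interleavings :: "('l, 'a label) cfg \<Rightarrow> 'a label idx list set" where
  "interleavings G =
     {\<tau> \<in> lists (Idx Act). \<forall>i. thread_word i \<tau> \<in> traces G \<union> {[]}}"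


section \<open>Mazurkiewicz reductions\<close>

inductive swap_order ::
  "('a label \<times> 'a label) set \<Rightarrow> 'a label idx list \<Rightarrow> 'a label idx list \<Rightarrow> bool" for I where
  swap_refl: "\<tau> \<in> lists (Idx Act) \<Longrightarrow> swap_order I \<tau> \<tau>"
| swap_trans: "swap_order I \<tau>1 \<tau>2 \<Longrightarrow> swap_order I \<tau>2 \<tau>3 \<Longrightarrow> swap_order I \<tau>1 \<tau>3"
| swap_step: "\<rho> \<in> lists (Idx Act) \<Longrightarrow> \<sigma> \<in> lists (Idx Act) \<Longrightarrow> a \<in> Act \<Longrightarrow> b \<in> Act \<Longrightarrow>
    (a, b) \<in> I \<Longrightarrow> i \<noteq> j \<Longrightarrow>
    swap_order I (\<rho> @ [(a, i), (b, j)] @ \<sigma>) (\<rho> @ [(b, j), (a, i)] @ \<sigma>)"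

definition mazurkiewicz_reduction ::
  "('a label \<times> 'a label) set \<Rightarrow> 'a label idx list set \<Rightarrow> 'a label idx list set \<Rightarrow> bool" where
  "mazurkiewicz_reduction I L1 L2 \<longleftrightarrow>
     L1 \<subseteq> L2 \<and> (\<forall>\<tau>\<in>L2. \<exists>\<tau>'\<in>L1. swap_order I \<tau> \<tau>')"


section \<open>Sync-points\<close>

text \<open>The threads taking part in a sync-point are listed in ascending order.\<close>

definition sync_word :: "nat set \<Rightarrow> 'a label idx list" where
  "sync_word T = map (\<lambda>t. (Bullet, t)) (sorted_list_of_set T)"

inductive sync_on :: "nat set \<Rightarrow> 'a label idx list \<Rightarrow> bool" where
  sync_empty: "sync_on {} []"
| sync_step: "finite T \<Longrightarrow> T \<noteq> {} \<Longrightarrow>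
    \<tau>1 \<in> kstar (lists (Act \<times> T) \<union> {sync_word T}) \<Longrightarrow>
    T' \<subset> T \<Longrightarrow> sync_on T' \<tau>2 \<Longrightarrow> sync_on T (\<tau>1 @ \<tau>2)"

definition sync :: "'a label idx list \<Rightarrow> bool" where
  "sync \<tau> \<longleftrightarrow> (\<exists>T. finite T \<and> sync_on T \<tau>)"

definition sync_instrumentation ::
  "('l, 'a label) cfg \<Rightarrow> ('m, 'a label) cfg \<Rightarrow> bool" where
  "sync_instrumentation G G' \<longleftrightarrow>
     control_flow_graph (Act \<union> {Bullet}) G' \<and>
     traces G = restrict_word Act ` traces G' \<and>
     (\<forall>\<tau>1\<in>traces G'. \<forall>\<tau>2\<in>traces G'.
        restrict_word Act \<tau>1 = restrict_word Act \<tau>2 \<longrightarrow> \<tau>1 = \<tau>2)"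

definition instrumented_interleavings ::
  "('m, 'a label) cfg \<Rightarrow> 'a label idx list set" where
  "instrumented_interleavings G' =
     restrict_word (Idx Act) `
       {\<tau> \<in> lists (Idx (Act \<union> {Bullet})).
          sync \<tau> \<and> (\<forall>i. thread_word i \<tau> \<in> traces G' \<union> {[]})}"

definition sound_instrumentation ::
  "('l, 'a label) cfg \<Rightarrow> ('a label \<times> 'a label) set \<Rightarrow> ('m, 'a label) cfg \<Rightarrow> bool" where
  "sound_instrumentation G I G' \<longleftrightarrow>
     mazurkiewicz_reduction I (instrumented_interleavings G') (interleavings G)"


section \<open>Polynomial time\<close>

text \<open>The machine model is the WHILE language on binary trees (N. D. Jones,
  \<^emph>\<open>Computability and Complexity from a Programming Perspective\<close>). Every evaluation of a
  subexpression costs the size of its value. A program has finitely many variables, so one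
  step can be simulated by a Turing machine in time polynomial in the input size plus
  the cost accumulated so far; conversely a Turing machine step is simulated on list-encoded
  half-tapes at cost linear in their length. Hence polynomial time in this model is
  polynomial time on Turing machines.\<close>

datatype tree = Leaf | Node tree tree

primrec tree_size :: "tree \<Rightarrow> nat" where
  "tree_size Leaf = 1"
| "tree_size (Node l r) = 1 + tree_size l + tree_size r"

datatype expr =
    EVar nat | ELeaf | ENode expr expr | ELeft expr | ERight expr | EEq expr expr

fun left_of :: "tree \<Rightarrow> tree" where
  "left_of Leaf = Leaf"
| "left_of (Node l r) = l"

fun right_of :: "tree \<Rightarrow> tree" where
  "right_of Leaf = Leaf"
| "right_of (Node l r) = r"

text \<open>As a truth value, \<open>Leaf\<close> is false and every other tree is true.\<close>

definition tree_of_bool :: "bool \<Rightarrow> tree" where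
  "tree_of_bool b = (if b then Node Leaf Leaf else Leaf)"

type_synonym store = "nat \<Rightarrow> tree"

primrec expr_val :: "expr \<Rightarrow> store \<Rightarrow> tree" where
  "expr_val (EVar x) s = s x"
| "expr_val ELeaf s = Leaf"
| "expr_val (ENode e f) s = Node (expr_val e s) (expr_val f s)"
| "expr_val (ELeft e) s = left_of (expr_val e s)"
| "expr_val (ERight e) s = right_of (expr_val e s)"
| "expr_val (EEq e f) s = tree_of_bool (expr_val e s = expr_val f s)"

primrec expr_cost :: "expr \<Rightarrow> store \<Rightarrow> nat" where
  "expr_cost (EVar x) s = tree_size (expr_val (EVar x) s)"
| "expr_cost ELeaf s = tree_size (expr_val ELeaf s)"
| "expr_cost (ENode e f) s = expr_cost e s + expr_cost f s + tree_size (expr_val (ENode e f) s)"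
| "expr_cost (ELeft e) s = expr_cost e s + tree_size (expr_val (ELeft e) s)"
| "expr_cost (ERight e) s = expr_cost e s + tree_size (expr_val (ERight e) s)"
| "expr_cost (EEq e f) s = expr_cost e s + expr_cost f s + tree_size (expr_val (EEq e f) s)"

datatype com = CSkip | CAssign nat expr | CSeq com com | CIf expr com com | CWhile expr com

text \<open>\<open>exec c s n s'\<close>: started in \<open>s\<close>, the program \<open>c\<close> terminates in \<open>s'\<close> at cost \<open>n\<close>.\<close>

inductive exec :: "com \<Rightarrow> store \<Rightarrow> nat \<Rightarrow> store \<Rightarrow> bool" where
  exec_skip: "exec CSkip s 1 s"
| exec_assign: "exec (CAssign x e) s (expr_cost e s) (s(x := expr_val e s))"
| exec_seq: "exec c s m s' \<Longrightarrow> exec d s' n s'' \<Longrightarrow> exec (CSeq c d) s (m + n) s''"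
| exec_if_true: "expr_val e s \<noteq> Leaf \<Longrightarrow> exec c s n s' \<Longrightarrow>
    exec (CIf e c d) s (expr_cost e s + n) s'"
| exec_if_false: "expr_val e s = Leaf \<Longrightarrow> exec d s n s' \<Longrightarrow>
    exec (CIf e c d) s (expr_cost e s + n) s'"
| exec_while_false: "expr_val e s = Leaf \<Longrightarrow> exec (CWhile e c) s (expr_cost e s) s"
| exec_while_true: "expr_val e s \<noteq> Leaf \<Longrightarrow> exec c s m s' \<Longrightarrow> exec (CWhile e c) s' n s'' \<Longrightarrow>
    exec (CWhile e c) s (expr_cost e s + m + n) s''"

definition input_store :: "tree \<Rightarrow> store" where
  "input_store t = (\<lambda>x. if x = 0 then t else Leaf)"

text \<open>Decision problem: given an instance \<open>x\<close> from \<open>Inst\<close>, decide whether \<open>Q x\<close>.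
  \<open>Enc x t\<close> says that \<open>t\<close> is an admissible encoding of \<open>x\<close>; one program, with one polynomial
  bound, has to answer correctly on all encodings of all instances. Trees that encode no
  instance are not inputs of the problem. Input and answer are passed in variable 0.\<close>

definition polytime_decidable ::
  "('i \<Rightarrow> tree \<Rightarrow> bool) \<Rightarrow> 'i set \<Rightarrow> ('i \<Rightarrow> bool) \<Rightarrow> bool" where
  "polytime_decidable Enc Inst Q \<longleftrightarrow>
     (\<exists>(c :: com) (p :: nat poly). \<forall>x\<in>Inst. \<forall>t. Enc x t \<longrightarrow>
        (\<exists>n s'. exec c (input_store t) n s' \<and>
                n \<le> poly p (tree_size t) \<and>
                (s' 0 \<noteq> Leaf \<longleftrightarrow> Q x)))"


section \<open>Encoding of problem instances\<close>

text \<open>Locations and action names are natural numbers, written in binary (least significant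
  bit first). Finite sets are given by listing their elements in any order.\<close>

fun bits :: "nat \<Rightarrow> bool list" where
  "bits n = (if n = 0 then [] else odd n # bits (n div 2))"

declare bits.simps [simp del]

definition enc_list :: "('x \<Rightarrow> tree) \<Rightarrow> 'x list \<Rightarrow> tree" where
  "enc_list f xs = foldr (\<lambda>x t. Node (f x) t) xs Leaf"

definition enc_nat :: "nat \<Rightarrow> tree" where
  "enc_nat n = enc_list tree_of_bool (bits n)"

fun enc_label :: "nat label \<Rightarrow> tree" where
  "enc_label Bullet = Leaf"
| "enc_label (Action a) = Node Leaf (enc_nat a)"

fun enc_edge :: "nat \<times> nat label \<times> nat \<Rightarrow> tree" where
  "enc_edge (l, a, l') = Node (enc_nat l) (Node (enc_label a) (enc_nat l'))"

fun enc_label_pair :: "nat label \<times> nat label \<Rightarrow> tree" where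
  "enc_label_pair (a, b) = Node (enc_label a) (enc_label b)"

definition encodes_set :: "('x \<Rightarrow> tree) \<Rightarrow> 'x set \<Rightarrow> tree \<Rightarrow> bool" where
  "encodes_set f X t \<longleftrightarrow> (\<exists>xs. set xs = X \<and> t = enc_list f xs)"

definition encodes_cfg :: "(nat, nat label) cfg \<Rightarrow> tree \<Rightarrow> bool" where
  "encodes_cfg G t \<longleftrightarrow>
     (\<exists>tl td. encodes_set enc_nat (locs G) tl \<and> encodes_set enc_edge (trans G) td \<and>
        t = Node (Node (enc_nat (init G)) (enc_nat (exit G))) (Node tl td))"

fun encodes_instance ::
  "(nat, nat label) cfg \<times> (nat label \<times> nat label) set \<times> (nat, nat label) cfg \<Rightarrow> tree \<Rightarrow> bool"
where
  "encodes_instance (G, I, G') t \<longleftrightarrow>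
     (\<exists>tG tI tG'. encodes_cfg G tG \<and> encodes_set enc_label_pair I tI \<and> encodes_cfg G' tG' \<and>
        t = Node tG (Node tI tG'))"

end

theory Submission imports Defs begin

text \<open>A letter of a thread has as its phase the number of sync-points before it in that
  thread's trace. An interleaving is admitted by the instrumentation iff phases never
  decrease along it, so a reduction must move every letter of a higher phase past all later
  letters of lower phases, and stably sorting by phase makes no other swaps. As the threads of
  \<open>P\<close> run independently, \<open>G'\<close> is sound iff \<open>(a, b) \<in> I\<close> whenever
  \<open>a\<close> can occur in \<open>G'\<close> in a higher phase than \<open>b\<close>. Splitting the first path right
  before the sync-point that puts it ahead turns this into two reachability questions, one of
  them in a product graph on pairs of locations. Such questions are decided in polynomial
  time by repeatedly scanning the list of edges.\<close>

section \<open>Polynomial-time functions and sets\<close>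

text \<open>Letters of an interleaving have phases although the sync-points are erased from it: by
  the injectivity required of an instrumentation, the trace of a thread fixes its instrumented
  trace. As any number of threads may run, any two traces of \<open>G'\<close>, possibly equal ones,
  can be executed one after the other by two distinct threads; hence a single pair of letters
  outside \<open>I\<close> already breaks soundness. Exchanges go in one direction only, higher
  phase over lower phase, so an asymmetric \<open>I\<close> causes no difficulty. Phases can grow
  without bound, since cycles may contain sync-points, and cannot be enumerated. The product graph
  therefore remembers only that two paths have passed equally many of them; once the first path is
  one ahead, its continuation needs no counting. On the machine side, inputs are lists in arbitrary
  order while the criterion is about sets. Computability is therefore developed for lists up to
  their sets of elements, with closure under exactly the operations from which the criterion is
  built.\<close>

lemma poly_nat_mono: "x \<le> y \<Longrightarrow> poly p x \<le> poly p (y::nat)"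
  by (induction p) (auto intro: add_mono mult_mono)

text \<open>Costs are functions of the whole input tree, so that the cost of a composition is simply
  \<open>bg t + bf (g t)\<close>; sizes enter only when such a bound is turned into a
  polynomial.\<close>

definition poly_bounded :: "(tree \<Rightarrow> nat) \<Rightarrow> bool" where
  "poly_bounded g \<longleftrightarrow> (\<exists>p. \<forall>t. g t \<le> poly p (tree_size t))"

lemma poly_bounded_const: "poly_bounded (\<lambda>t. n)"
  unfolding poly_bounded_def by (rule exI[of _ "[:n:]"]) simp

lemma poly_bounded_size: "poly_bounded tree_size"
  unfolding poly_bounded_def by (rule exI[of _ "[:0, 1:]"]) simp

lemma poly_bounded_add:
  assumes "poly_bounded f" "poly_bounded g"
  shows "poly_bounded (\<lambda>t. f t + g t)"
proof -
  obtain p q where "\<forall>t. f t \<le> poly p (tree_size t)" "\<forall>t. g t \<le> poly q (tree_size t)"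
    using assms unfolding poly_bounded_def by blast
  then have "\<forall>t. f t + g t \<le> poly (p + q) (tree_size t)"
    by (simp add: add_mono)
  then show ?thesis unfolding poly_bounded_def by blast
qed

lemma poly_bounded_mult:
  assumes "poly_bounded f" "poly_bounded g"
  shows "poly_bounded (\<lambda>t. f t * g t)"
proof -
  obtain p q where "\<forall>t. f t \<le> poly p (tree_size t)" "\<forall>t. g t \<le> poly q (tree_size t)"
    using assms unfolding poly_bounded_def by blast
  then have "\<forall>t. f t * g t \<le> poly (p * q) (tree_size t)"
    by (simp add: mult_mono)
  then show ?thesis unfolding poly_bounded_def by blast
qed

lemma poly_bounded_poly:
  assumes "poly_bounded g"
  shows "poly_bounded (\<lambda>t. poly p (g t))"
proof -
  obtain q where "\<forall>t. g t \<le> poly q (tree_size t)"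
    using assms unfolding poly_bounded_def by blast
  then have "\<forall>t. poly p (g t) \<le> poly (pcompose p q) (tree_size t)"
    by (simp add: poly_pcompose poly_nat_mono)
  then show ?thesis unfolding poly_bounded_def by blast
qed

lemma poly_bounded_mono:
  assumes "poly_bounded g" "\<And>t. f t \<le> g t"
  shows "poly_bounded f"
  using assms unfolding poly_bounded_def by (meson le_trans)

lemma poly_bounded_comp:
  assumes "poly_bounded g" "poly_bounded (\<lambda>t. tree_size (f t))"
  shows "poly_bounded (\<lambda>t. g (f t))"
proof -
  obtain p where "\<forall>t. g t \<le> poly p (tree_size t)"
    using assms(1) unfolding poly_bounded_def by blast
  then show ?thesis
    using poly_bounded_poly[OF assms(2), of p] by (meson poly_bounded_mono)
qed

lemmas poly_bounded_intros = poly_bounded_const poly_bounded_size poly_bounded_add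
  poly_bounded_mult poly_bounded_poly

lemma tree_size_pos [simp]: "0 < tree_size t"
  by (cases t) auto

lemma left_size: "tree_size (left_of t) \<le> tree_size t"
  by (cases t) auto

lemma right_size: "tree_size (right_of t) \<le> tree_size t"
  by (cases t) auto

lemma size_le_cost: "tree_size (expr_val e s) \<le> expr_cost e s"
  by (cases e) auto

text \<open>Every assignment pays for the size of the value that it stores, so no variable can
  outgrow the time spent. This turns time bounds into size bounds.\<close>

lemma exec_size: "exec c s n s' \<Longrightarrow> tree_size (s' x) \<le> tree_size (s x) + n"
proof (induction rule: exec.induct)
  case (exec_assign y e s)
  then show ?case using size_le_cost[of e s] by auto
qed auto

text \<open>Variables from \<open>k\<close> on are left unchanged, so they can be used to
  save values across calls.\<close>

definition computes :: "com \<Rightarrow> nat \<Rightarrow> (tree \<Rightarrow> nat) \<Rightarrow> (tree \<Rightarrow> tree) \<Rightarrow> bool" where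
  "computes c k g f \<longleftrightarrow> 0 < k \<and> poly_bounded g \<and>
     (\<forall>s. \<exists>n s'. exec c s n s' \<and> n \<le> g (s 0) \<and> s' 0 = f (s 0) \<and> (\<forall>x\<ge>k. s' x = s x))"

definition ptime :: "(tree \<Rightarrow> tree) \<Rightarrow> bool" where
  "ptime f \<longleftrightarrow> (\<exists>c k g. computes c k g f)"

lemma computesE:
  assumes "computes c k g f"
  obtains n s' where "exec c s n s'" "n \<le> g (s 0)" "s' 0 = f (s 0)" "\<And>x. k \<le> x \<Longrightarrow> s' x = s x"
  using assms unfolding computes_def by blast

lemma computes_bounded: "computes c k g f \<Longrightarrow> poly_bounded g"
  unfolding computes_def by blast

lemma computes_mono: "computes c k g f \<Longrightarrow> k \<le> k' \<Longrightarrow> computes c k' g f"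
  unfolding computes_def by (meson le_trans less_le_trans)

text \<open>This bound is what keeps the cost of a second program polynomial when it is run on the
  output of a first one.\<close>

lemma ptime_size: "ptime f \<Longrightarrow> poly_bounded (\<lambda>t. tree_size (f t))"
proof -
  assume "ptime f"
  then obtain c k g where c: "computes c k g f" unfolding ptime_def by blast
  have "tree_size (f t) \<le> tree_size t + g t" for t
  proof -
    obtain n s' where "exec c (\<lambda>_. t) n s'" "n \<le> g t" "s' 0 = f t"
      using c by (rule computesE[where s = "\<lambda>_. t"])
    then show ?thesis using exec_size[of c "\<lambda>_. t" n s' 0] by simp
  qed
  moreover have "poly_bounded (\<lambda>t. tree_size t + g t)"
    by (intro poly_bounded_intros c[THEN computes_bounded])
  ultimately show ?thesis by (rule poly_bounded_mono[rotated])
qed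

section \<open>Composition, pairing and branching of programs\<close>

lemma ptime_assign:
  assumes "\<And>s. expr_val e s = f (s 0)" "\<And>s. expr_cost e s \<le> g (s 0)" "poly_bounded g"
  shows "ptime f"
proof -
  have "exec (CAssign 0 e) s (expr_cost e s) (s(0 := f (s 0)))" for s
    using exec_assign[of 0 e s] assms(1) by simp
  then have "computes (CAssign 0 e) 1 g f"
    unfolding computes_def using assms(2,3) by fastforce
  then show ?thesis unfolding ptime_def by blast
qed

lemma ptime_id: "ptime (\<lambda>t. t)"
  by (rule ptime_assign[of "EVar 0" _ tree_size]) (auto intro: poly_bounded_intros)

lemma ptime_Leaf: "ptime (\<lambda>t. Leaf)"
  by (rule ptime_assign[of ELeaf _ "\<lambda>_. 1"]) (auto intro: poly_bounded_intros)

lemma ptime_comp: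
  assumes "ptime f" "ptime g"
  shows "ptime (\<lambda>t. f (g t))"
proof -
  obtain cf kf bf where f: "computes cf kf bf f" using assms(1) unfolding ptime_def by blast
  obtain cg kg bg where g: "computes cg kg bg g" using assms(2) unfolding ptime_def by blast
  have "computes (CSeq cg cf) (max kf kg) (\<lambda>t. bg t + bf (g t)) (\<lambda>t. f (g t))"
    unfolding computes_def
  proof (intro conjI allI)
    show "0 < max kf kg" using f unfolding computes_def by auto
    show "poly_bounded (\<lambda>t. bg t + bf (g t))"
      using f g ptime_size[OF assms(2)] poly_bounded_comp[of bf g]
      by (auto intro!: poly_bounded_intros dest: computes_bounded)
    fix s :: store
    obtain n1 s1 where 1: "exec cg s n1 s1" "n1 \<le> bg (s 0)" "s1 0 = g (s 0)"
      "\<And>x. kg \<le> x \<Longrightarrow> s1 x = s x"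
      using computesE[OF g, of s] by blast
    obtain n2 s2 where 2: "exec cf s1 n2 s2" "n2 \<le> bf (s1 0)" "s2 0 = f (s1 0)"
      "\<And>x. kf \<le> x \<Longrightarrow> s2 x = s1 x"
      using computesE[OF f, of s1] by blast
    show "\<exists>n s'. exec (CSeq cg cf) s n s' \<and> n \<le> bg (s 0) + bf (g (s 0)) \<and>
        s' 0 = f (g (s 0)) \<and> (\<forall>x\<ge>max kf kg. s' x = s x)"
      using exec_seq[OF 1(1) 2(1)] 1 2 by (intro exI[of _ "n1 + n2"] exI[of _ s2]) auto
  qed
  then show ?thesis unfolding ptime_def by blast
qed

lemma ptime_left: "ptime f \<Longrightarrow> ptime (\<lambda>t. left_of (f t))"
proof (rule ptime_comp[of left_of])
  show "ptime left_of"
    by (rule ptime_assign[of "ELeft (EVar 0)" _ "\<lambda>t. tree_size t + tree_size t"])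
      (auto intro: poly_bounded_intros left_size right_size)
qed

lemma ptime_right: "ptime f \<Longrightarrow> ptime (\<lambda>t. right_of (f t))"
proof (rule ptime_comp[of right_of])
  show "ptime right_of"
    by (rule ptime_assign[of "ERight (EVar 0)" _ "\<lambda>t. tree_size t + tree_size t"])
      (auto intro: poly_bounded_intros left_size right_size)
qed

lemma ptime_Node:
  assumes "ptime f" "ptime g"
  shows "ptime (\<lambda>t. Node (f t) (g t))"
proof -
  obtain cf kf bf where f: "computes cf kf bf f" using assms(1) unfolding ptime_def by blast
  obtain cg kg bg where g: "computes cg kg bg g" using assms(2) unfolding ptime_def by blast
  define k where "k = max kf kg"
  \<comment> \<open>Variable \<open>k\<close> keeps the input and \<open>k + 1\<close> the first
    result; both lie beyond the variables that \<open>cf\<close> and \<open>cg\<close> may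
    overwrite.\<close>
  define c where "c = CSeq (CAssign k (EVar 0)) (CSeq cf (CSeq (CAssign (k + 1) (EVar 0))
    (CSeq (CAssign 0 (EVar k)) (CSeq cg (CAssign 0 (ENode (EVar (k + 1)) (EVar 0)))))))"
  \<comment> \<open>Two copies of the input, the two calls, one copy of \<open>f t\<close>, and the
    final pair, whose components are paid for once when read and once inside the new node.\<close>
  define b where "b = (\<lambda>t. 2 * tree_size t + bf t + bg t +
    3 * tree_size (f t) + 2 * tree_size (g t) + 1)"
  have k0: "0 < k" using f unfolding computes_def k_def by auto
  have f: "computes cf k bf f" and g: "computes cg k bg g"
    using f g by (auto simp: k_def intro: computes_mono)
  have "computes c (k + 2) b (\<lambda>t. Node (f t) (g t))"
    unfolding computes_def
  proof (intro conjI allI)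
    show "poly_bounded b"
      unfolding b_def by (intro poly_bounded_intros f[THEN computes_bounded]
        g[THEN computes_bounded] assms[THEN ptime_size])
    fix s :: store
    define s0 where "s0 = s(k := s 0)"
    obtain n1 s1 where 1: "exec cf s0 n1 s1" "n1 \<le> bf (s0 0)" "s1 0 = f (s0 0)"
      "\<And>x. k \<le> x \<Longrightarrow> s1 x = s0 x"
      using computesE[OF f, of s0] by blast
    define s2 where "s2 = (s1(k + 1 := s1 0))(0 := s0 k)"
    obtain n3 s3 where 3: "exec cg s2 n3 s3" "n3 \<le> bg (s2 0)" "s3 0 = g (s2 0)"
      "\<And>x. k \<le> x \<Longrightarrow> s3 x = s2 x"
      using computesE[OF g, of s2] by blast
    define s4 where "s4 = s3(0 := Node (f (s 0)) (g (s 0)))"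
    have e0: "exec (CAssign k (EVar 0)) s (tree_size (s 0)) s0"
      using exec_assign[of k "EVar 0" s] by (simp add: s0_def)
    have e1: "exec (CAssign (k + 1) (EVar 0)) s1 (tree_size (f (s 0))) (s1(k + 1 := s1 0))"
      using exec_assign[of "k + 1" "EVar 0" s1] k0 1(3) by (simp add: s0_def)
    have e2: "exec (CAssign 0 (EVar k)) (s1(k + 1 := s1 0)) (tree_size (s 0)) s2"
      using exec_assign[of 0 "EVar k" "s1(k + 1 := s1 0)"] k0 1(4)[of k]
      by (simp add: s2_def s0_def)
    have v: "s3 (k + 1) = f (s 0)" "s3 0 = g (s 0)"
      using 1(3) 3(3) 3(4)[of "k + 1"] k0 by (auto simp: s2_def s0_def)
    have e3: "exec (CAssign 0 (ENode (EVar (k + 1)) (EVar 0))) s3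
        (2 * tree_size (f (s 0)) + 2 * tree_size (g (s 0)) + 1) s4"
      using exec_assign[of 0 "ENode (EVar (k + 1)) (EVar 0)" s3] v
      by (simp add: s4_def mult_2 add_ac)
    note ex = exec_seq[OF e0 exec_seq[OF 1(1) exec_seq[OF e1 exec_seq[OF e2
      exec_seq[OF 3(1) e3]]]]]
    show "\<exists>n s'. exec c s n s' \<and> n \<le> b (s 0) \<and> s' 0 = Node (f (s 0)) (g (s 0)) \<and>
        (\<forall>x\<ge>k + 2. s' x = s x)"
      unfolding c_def by ((rule exI)+, rule conjI, rule ex)
        (use 1(2,4) 3(2,4) k0 in \<open>auto simp: b_def s4_def s2_def s0_def\<close>)
  qed auto
  then show ?thesis unfolding ptime_def by blast
qed

definition ptime_pred :: "(tree \<Rightarrow> bool) \<Rightarrow> bool" where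
  "ptime_pred P \<longleftrightarrow> ptime (\<lambda>t. tree_of_bool (P t))"

lemma tree_of_bool_eq_Leaf [simp]: "tree_of_bool b = Leaf \<longleftrightarrow> \<not> b"
  by (simp add: tree_of_bool_def)

lemma tree_of_bool_inject [simp]: "tree_of_bool a = tree_of_bool b \<longleftrightarrow> a = b"
  by (simp add: tree_of_bool_def)

lemma tree_size_of_bool: "tree_size (tree_of_bool b) \<le> 3"
  by (simp add: tree_of_bool_def)

lemma ptime_if:
  assumes "ptime_pred P" "ptime f" "ptime g"
  shows "ptime (\<lambda>t. if P t then f t else g t)"
proof -
  obtain ch kh bh where h: "computes ch kh bh (\<lambda>t. tree_of_bool (P t))"
    using assms(1) unfolding ptime_pred_def ptime_def by blast
  obtain cf kf bf where f: "computes cf kf bf f" using assms(2) unfolding ptime_def by blast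
  obtain cg kg bg where g: "computes cg kg bg g" using assms(3) unfolding ptime_def by blast
  define k where "k = max kh (max kf kg)"
  define c where "c = CSeq (CAssign k (EVar 0)) (CSeq ch (CSeq (CAssign (k + 1) (EVar 0))
    (CSeq (CAssign 0 (EVar k)) (CIf (EVar (k + 1)) cf cg))))"
  \<comment> \<open>The 6 pays for saving and for testing a truth value of size at most 3; adding
    the costs of both branches avoids a case distinction in the bound.\<close>
  define b where "b = (\<lambda>t. 2 * tree_size t + bh t + 6 + (bf t + bg t))"
  have k0: "0 < k" using h unfolding computes_def k_def by auto
  have h: "computes ch k bh (\<lambda>t. tree_of_bool (P t))"
    and f: "computes cf k bf f" and g: "computes cg k bg g"
    using h f g by (auto simp: k_def intro: computes_mono)
  have "computes c (k + 2) b (\<lambda>t. if P t then f t else g t)"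
    unfolding computes_def
  proof (intro conjI allI)
    show "poly_bounded b"
      unfolding b_def by (intro poly_bounded_intros h[THEN computes_bounded]
        f[THEN computes_bounded] g[THEN computes_bounded])
    fix s :: store
    define s0 where "s0 = s(k := s 0)"
    obtain n1 s1 where 1: "exec ch s0 n1 s1" "n1 \<le> bh (s0 0)" "s1 0 = tree_of_bool (P (s0 0))"
      "\<And>x. k \<le> x \<Longrightarrow> s1 x = s0 x"
      using computesE[OF h, of s0] by blast
    define s2 where "s2 = (s1(k + 1 := s1 0))(0 := s0 k)"
    have s2: "s2 0 = s 0" "s2 (k + 1) = tree_of_bool (P (s 0))" "\<And>x. k + 2 \<le> x \<Longrightarrow> s2 x = s x"
      using 1(3,4) k0 by (auto simp: s2_def s0_def)
    have e0: "exec (CAssign k (EVar 0)) s (tree_size (s 0)) s0"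
      using exec_assign[of k "EVar 0" s] by (simp add: s0_def)
    have e1: "exec (CAssign (k + 1) (EVar 0)) s1 (tree_size (tree_of_bool (P (s 0))))
        (s1(k + 1 := s1 0))"
      using exec_assign[of "k + 1" "EVar 0" s1] k0 1(3) by (simp add: s0_def)
    have e2: "exec (CAssign 0 (EVar k)) (s1(k + 1 := s1 0)) (tree_size (s 0)) s2"
      using exec_assign[of 0 "EVar k" "s1(k + 1 := s1 0)"] k0 1(4)[of k]
      by (simp add: s2_def s0_def)
    obtain n3 s3 where 3: "exec (CIf (EVar (k + 1)) cf cg) s2 n3 s3"
      "n3 \<le> tree_size (tree_of_bool (P (s 0))) + (bf (s 0) + bg (s 0))"
      "s3 0 = (if P (s 0) then f (s 0) else g (s 0))" "\<And>x. k \<le> x \<Longrightarrow> s3 x = s2 x"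
    proof (cases "P (s 0)")
      case True
      obtain n s' where *: "exec cf s2 n s'" "n \<le> bf (s2 0)" "s' 0 = f (s2 0)"
        "\<And>x. k \<le> x \<Longrightarrow> s' x = s2 x"
        using computesE[OF f, of s2] by blast
      have "exec (CIf (EVar (k + 1)) cf cg) s2 (expr_cost (EVar (k + 1)) s2 + n) s'"
        by (rule exec_if_true) (use True s2(2) *(1) in auto)
      then show ?thesis by (rule that) (use * True s2 in auto)
    next
      case False
      obtain n s' where *: "exec cg s2 n s'" "n \<le> bg (s2 0)" "s' 0 = g (s2 0)"
        "\<And>x. k \<le> x \<Longrightarrow> s' x = s2 x"
        using computesE[OF g, of s2] by blast
      have "exec (CIf (EVar (k + 1)) cf cg) s2 (expr_cost (EVar (k + 1)) s2 + n) s'"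
        by (rule exec_if_false) (use False s2(2) *(1) in auto)
      then show ?thesis by (rule that) (use * False s2 in auto)
    qed
    note ex = exec_seq[OF e0 exec_seq[OF 1(1) exec_seq[OF e1 exec_seq[OF e2 3(1)]]]]
    have n1: "n1 \<le> bh (s 0)" using 1(2) k0 by (simp add: s0_def)
    show "\<exists>n s'. exec c s n s' \<and> n \<le> b (s 0) \<and>
        s' 0 = (if P (s 0) then f (s 0) else g (s 0)) \<and> (\<forall>x\<ge>k + 2. s' x = s x)"
      unfolding c_def by ((rule exI)+, rule conjI, rule ex)
        (use n1 3 s2(3) tree_size_of_bool[of "P (s 0)"] in \<open>auto simp: b_def\<close>)
  qed auto
  then show ?thesis unfolding ptime_def by blast
qed

section \<open>Loops over lists\<close>

text \<open>Every tree is the \<open>enc_list\<close> of the list of its elements.\<close>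

fun elems :: "tree \<Rightarrow> tree list" where
  "elems Leaf = []"
| "elems (Node x xs) = x # elems xs"

lemma elems_enc_list [simp]: "elems (enc_list f xs) = map f xs"
  by (induction xs) (auto simp: enc_list_def)

lemma length_elems: "length (elems t) < tree_size t"
  by (induction t) auto

lemma size_in_elems: "x \<in> set (elems t) \<Longrightarrow> tree_size x \<le> tree_size t"
  by (induction t) auto

text \<open>Variable \<open>k\<close> holds the environment, \<open>k + 1\<close> the rest of the
  list and \<open>k + 2\<close> the accumulator. The accumulator plus \<open>g\<close> for each
  remaining element stays below \<open>Z\<close>, so one and the same number bounds the cost of
  every round throughout the induction.\<close>

lemma while_fold:
  fixes h :: "tree \<Rightarrow> tree" and g :: nat
  defines "st \<equiv> \<lambda>e x a. h (Node e (Node x a))"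
  assumes ch: "computes ch k bh h" and bh: "\<And>t. bh t \<le> poly p (tree_size t)"
    and "tree_size (s k) \<le> Z" "tree_size (s (k + 1)) \<le> Z"
      "tree_size (s (k + 2)) + length (elems (s (k + 1))) * g \<le> Z"
      "\<And>x a. x \<in> set (elems (s (k + 1))) \<Longrightarrow> tree_size (st (s k) x a) \<le> tree_size a + g"
  shows "\<exists>n s'. exec (CWhile (EVar (k + 1)) (CSeq
             (CAssign 0 (ENode (EVar k) (ENode (ELeft (EVar (k + 1))) (EVar (k + 2)))))
             (CSeq ch (CSeq (CAssign (k + 2) (EVar 0))
             (CAssign (k + 1) (ERight (EVar (k + 1)))))))) s n s' \<and>
           n \<le> (length (elems (s (k + 1))) + 1) * (poly p (3 * Z + 2) + 14 * Z + 3) \<and>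
           s' (k + 2) = fold (st (s k)) (elems (s (k + 1))) (s (k + 2)) \<and>
           (\<forall>x\<ge>k + 3. s' x = s x)"
    (is "\<exists>n s'. exec (CWhile _ ?body) _ _ _ \<and> _")
  using assms(4-)
proof (induction "elems (s (k + 1))" arbitrary: s)
  case Nil
  then have 0: "s (k + 1) = Leaf" by (metis elems.elims list.discI)
  have *: "exec (CWhile (EVar (k + 1)) ?body) s (expr_cost (EVar (k + 1)) s) s"
    by (rule exec_while_false) (use 0 in simp)
  show ?case by ((rule exI)+, rule conjI, rule *) (use 0 in auto)
next
  case (Cons x xs)
  obtain y where y: "s (k + 1) = Node x y" and xs: "xs = elems y"
    using Cons.hyps(2) by (cases "s (k + 1)") auto
  have k0: "0 < k" using ch unfolding computes_def by blast
  define s0 where "s0 = s(0 := Node (s k) (Node x (s (k + 2))))"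
  obtain n1 s1 where 1: "exec ch s0 n1 s1" "n1 \<le> bh (s0 0)" "s1 0 = h (s0 0)"
    "\<And>x. k \<le> x \<Longrightarrow> s1 x = s0 x"
    using computesE[OF ch, of s0] by blast
  define a where "a = st (s k) x (s (k + 2))"
  have a1: "s1 0 = a" using 1(3) by (simp add: a_def st_def s0_def)
  define s2 where "s2 = s1(k + 2 := a, k + 1 := y)"
  have s1: "s1 (k + 1) = Node x y" using 1(4)[of "k + 1"] y by (simp add: s0_def)
  have s2: "s2 k = s k" "s2 (k + 1) = y" "s2 (k + 2) = a" "\<And>x. k + 3 \<le> x \<Longrightarrow> s2 x = s x"
    using 1(4) k0 by (auto simp: s2_def s0_def)
  have a: "tree_size a \<le> tree_size (s (k + 2)) + g"
    using Cons.prems(4)[of x "s (k + 2)"] y by (simp add: a_def)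
  have Z: "tree_size (s k) \<le> Z" "tree_size x + tree_size y + 1 \<le> Z" "tree_size (s (k + 2)) \<le> Z"
    "tree_size a + length xs * g \<le> Z"
    using Cons.prems(1-3) y xs a by auto
  have "\<exists>n s'. exec (CWhile (EVar (k + 1)) ?body) s2 n s' \<and>
           n \<le> (length (elems (s2 (k + 1))) + 1) * (poly p (3 * Z + 2) + 14 * Z + 3) \<and>
           s' (k + 2) = fold (st (s2 k)) (elems (s2 (k + 1))) (s2 (k + 2)) \<and>
           (\<forall>x\<ge>k + 3. s' x = s2 x)"
  proof (rule Cons.hyps(1))
    show "xs = elems (s2 (k + 1))" by (simp only: s2 xs)
    show "tree_size (st (s2 k) x a) \<le> tree_size a + g" if "x \<in> set (elems (s2 (k + 1)))" for x a
      using Cons.prems(4)[of x a] that unfolding s2 y by simp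
  qed (use Z in \<open>unfold s2 xs, auto\<close>)
  then obtain n s' where ih: "exec (CWhile (EVar (k + 1)) ?body) s2 n s'"
    "n \<le> (length xs + 1) * (poly p (3 * Z + 2) + 14 * Z + 3)"
    "s' (k + 2) = fold (st (s k)) xs a" "\<forall>x\<ge>k + 3. s' x = s x"
    unfolding s2 xs[symmetric] using s2(4) by (elim exE conjE) (rule that, simp_all)
  let ?e = "ENode (EVar k) (ENode (ELeft (EVar (k + 1))) (EVar (k + 2)))"
  have e0: "exec (CAssign 0 ?e) s (expr_cost ?e s) s0"
    using exec_assign[of 0 ?e s] y by (simp add: s0_def)
  have e1: "exec (CAssign (k + 2) (EVar 0)) s1 (tree_size a) (s1(k + 2 := a))"
    using exec_assign[of "k + 2" "EVar 0" s1] a1 by simp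
  have e2: "exec (CAssign (k + 1) (ERight (EVar (k + 1)))) (s1(k + 2 := a))
      (tree_size (Node x y) + tree_size y) s2"
    using exec_assign[of "k + 1" "ERight (EVar (k + 1))" "s1(k + 2 := a)"] s1
    by (simp add: s2_def fun_upd_twist)
  note body = exec_seq[OF e0 exec_seq[OF 1(1) exec_seq[OF e1 e2]]]
  \<comment> \<open>\<open>3 * Z + 2\<close> bounds the argument of the call, which has three
    components and two nodes.\<close>
  have costs: "n1 \<le> poly p (3 * Z + 2)" "expr_cost ?e s \<le> 10 * Z + 3" "tree_size a \<le> Z"
  proof -
    have "n1 \<le> poly p (tree_size (s0 0))" using 1(2) bh[of "s0 0"] by simp
    also have "\<dots> \<le> poly p (3 * Z + 2)"
      by (rule poly_nat_mono) (use Z in \<open>auto simp: s0_def\<close>)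
    finally show "n1 \<le> poly p (3 * Z + 2)" .
    show "expr_cost ?e s \<le> 10 * Z + 3" using Z y by simp
    show "tree_size a \<le> Z" using Z(4) by linarith
  qed
  define m where "m = expr_cost (EVar (k + 1)) s + (expr_cost ?e s + (n1 + (tree_size a +
      (tree_size (Node x y) + tree_size y))))"
  \<comment> \<open>Of the 14 copies of \<open>Z\<close>, one is for the loop test, ten are for
    building the argument, one for saving the result and two for advancing the list.\<close>
  define W where "W = poly p (3 * Z + 2) + 14 * Z + 3"
  have "expr_cost (EVar (k + 1)) s = tree_size x + tree_size y + 1"
    "tree_size (Node x y) = tree_size x + tree_size y + 1"
    using y by simp_all
  then have "m \<le> W"
    using costs Z unfolding m_def W_def by linarith
  then have "m + n \<le> (length (elems (s (k + 1))) + 1) * W"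
    using ih(2) unfolding W_def[symmetric] y xs by simp
  moreover have "exec (CWhile (EVar (k + 1)) ?body) s (m + n) s'"
    unfolding m_def by (rule exec_while_true[OF _ body ih(1)]) (use y in simp)
  moreover have "s' (k + 2) = fold (st (s k)) (elems (s (k + 1))) (s (k + 2))"
    unfolding y using ih(3) by (simp add: xs a_def)
  ultimately show ?case
    using ih(4) unfolding W_def by blast
qed

text \<open>Bounding the growth of the accumulator in each round by the size of the other
  arguments makes the growth over the whole loop polynomial.\<close>

lemma ptime_fold_tree:
  assumes h: "ptime h"
    and growth: "\<And>e x a. tree_size (h (Node e (Node x a))) \<le>
      tree_size a + poly q (tree_size e + tree_size x)"
  shows "ptime (\<lambda>u. fold (\<lambda>x a. h (Node (left_of u) (Node x a)))
    (elems (left_of (right_of u))) (right_of (right_of u)))"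
proof -
  obtain ch k bh where ch: "computes ch k bh h" using h unfolding ptime_def by blast
  then obtain p where p: "\<And>t. bh t \<le> poly p (tree_size t)"
    unfolding computes_def poly_bounded_def by blast
  have k0: "0 < k" using ch unfolding computes_def by blast
  define loop where "loop = CWhile (EVar (k + 1)) (CSeq
    (CAssign 0 (ENode (EVar k) (ENode (ELeft (EVar (k + 1))) (EVar (k + 2)))))
    (CSeq ch (CSeq (CAssign (k + 2) (EVar 0)) (CAssign (k + 1) (ERight (EVar (k + 1)))))))"
  define c where "c = CSeq (CAssign k (ELeft (EVar 0)))
    (CSeq (CAssign (k + 1) (ELeft (ERight (EVar 0))))
    (CSeq (CAssign (k + 2) (ERight (ERight (EVar 0))))
    (CSeq loop (CAssign 0 (EVar (k + 2))))))"
  \<comment> \<open>The environment and a list element are each no larger than the input, hence the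
    factor 2. \<open>Z\<close> then allows \<open>tree_size t\<close> rounds of growth
    \<open>g t\<close>, more than the list has elements.\<close>
  define g where "g = (\<lambda>t. poly q (2 * tree_size t))"
  define Z where "Z = (\<lambda>t. tree_size t + tree_size t * g t)"
  define W where "W = (\<lambda>t. (tree_size t + 1) * (poly p (3 * Z t + 2) + 14 * Z t + 3))"
  \<comment> \<open>The three initial assignments cost at most 2, 3 and 3 times the input size and
    the loop at most \<open>W t\<close>; the result copied at the end has size at most
    \<open>tree_size t + W t\<close>.\<close>
  define b where "b = (\<lambda>t. 9 * tree_size t + 2 * W t)"
  define F where "F = (\<lambda>u. fold (\<lambda>x a. h (Node (left_of u) (Node x a)))
    (elems (left_of (right_of u))) (right_of (right_of u)))"
  have "computes c (k + 3) b F"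
    unfolding computes_def
  proof (intro conjI allI)
    have "poly_bounded Z"
      unfolding Z_def g_def by (intro poly_bounded_intros)
    then show "poly_bounded b"
      unfolding b_def W_def by (intro poly_bounded_intros)
    fix s :: store
    define t where "t = s 0"
    define s0 where "s0 = s(k := left_of t, k + 1 := left_of (right_of t),
      k + 2 := right_of (right_of t))"
    have sizes: "tree_size (left_of t) \<le> tree_size t" "tree_size (right_of t) \<le> tree_size t"
      "tree_size (left_of (right_of t)) \<le> tree_size t"
      "tree_size (right_of (right_of t)) \<le> tree_size t"
      by (auto intro: left_size right_size le_trans[OF left_size] le_trans[OF right_size])
    have len: "length (elems (left_of (right_of t))) \<le> tree_size t"
      using length_elems[of "left_of (right_of t)"] sizes by linarith
    have "\<exists>n s'. exec loop s0 n s' \<and>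
           n \<le> (length (elems (s0 (k + 1))) + 1) * (poly p (3 * Z t + 2) + 14 * Z t + 3) \<and>
           s' (k + 2) = fold (\<lambda>x a. h (Node (s0 k) (Node x a))) (elems (s0 (k + 1))) (s0 (k + 2)) \<and>
           (\<forall>x\<ge>k + 3. s' x = s0 x)"
      unfolding loop_def
    proof (rule while_fold[where g = "g t", OF ch p])
      show "tree_size (s0 k) \<le> Z t" "tree_size (s0 (k + 1)) \<le> Z t"
        using sizes by (auto simp: s0_def Z_def intro: trans_le_add1)
      show "tree_size (s0 (k + 2)) + length (elems (s0 (k + 1))) * g t \<le> Z t"
        using sizes len by (auto simp: s0_def Z_def intro!: add_mono)
      fix x a assume "x \<in> set (elems (s0 (k + 1)))"
      then have "tree_size x \<le> tree_size t"
        using size_in_elems sizes(3) by (fastforce simp: s0_def)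
      then have "poly q (tree_size (left_of t) + tree_size x) \<le> g t"
        unfolding g_def using sizes(1) by (intro poly_nat_mono) linarith
      then show "tree_size (h (Node (s0 k) (Node x a))) \<le> tree_size a + g t"
        using growth[of "left_of t" x a] by (simp add: s0_def)
    qed
    then obtain n s' where s': "exec loop s0 n s'"
      "n \<le> (length (elems (s0 (k + 1))) + 1) * (poly p (3 * Z t + 2) + 14 * Z t + 3)"
      "s' (k + 2) = fold (\<lambda>x a. h (Node (s0 k) (Node x a))) (elems (s0 (k + 1))) (s0 (k + 2))"
      "\<forall>x\<ge>k + 3. s' x = s0 x"
      by blast
    have s0: "s0 k = left_of t" "s0 (k + 1) = left_of (right_of t)"
      "s0 (k + 2) = right_of (right_of t)"
      by (auto simp: s0_def)
    have "(length (elems (left_of (right_of t))) + 1) *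
        (poly p (3 * Z t + 2) + 14 * Z t + 3) \<le> W t"
      unfolding W_def using len by (intro mult_right_mono) auto
    with s'(2) have n: "n \<le> W t" unfolding s0 by linarith
    have F: "s' (k + 2) = F t" using s'(3) unfolding s0 F_def .
    have e0: "exec (CAssign k (ELeft (EVar 0))) s (tree_size t + tree_size (left_of t))
        (s(k := left_of t))"
      using exec_assign[of k "ELeft (EVar 0)" s] by (simp add: t_def)
    have e1: "exec (CAssign (k + 1) (ELeft (ERight (EVar 0)))) (s(k := left_of t))
        (tree_size t + tree_size (right_of t) + tree_size (left_of (right_of t)))
        (s(k := left_of t, k + 1 := left_of (right_of t)))"
      using exec_assign[of "k + 1" "ELeft (ERight (EVar 0))" "s(k := left_of t)"] k0
      by (simp add: t_def)
    have e2: "exec (CAssign (k + 2) (ERight (ERight (EVar 0))))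
        (s(k := left_of t, k + 1 := left_of (right_of t)))
        (tree_size t + tree_size (right_of t) + tree_size (right_of (right_of t))) s0"
      using exec_assign[of "k + 2" "ERight (ERight (EVar 0))"
          "s(k := left_of t, k + 1 := left_of (right_of t))"] k0
      by (simp add: t_def s0_def)
    have e3: "exec (CAssign 0 (EVar (k + 2))) s' (tree_size (F t)) (s'(0 := F t))"
      using exec_assign[of 0 "EVar (k + 2)" s'] F by simp
    have sF: "tree_size (F t) \<le> tree_size t + W t"
      using exec_size[OF s'(1), of "k + 2"] n sizes(4) unfolding s0 F by linarith
    show "\<exists>n s'. exec c s n s' \<and> n \<le> b (s 0) \<and> s' 0 = F (s 0) \<and> (\<forall>x\<ge>k + 3. s' x = s x)"
      unfolding c_def t_def[symmetric]
      by ((rule exI)+, rule conjI, rule exec_seq[OF e0 exec_seq[OF e1 exec_seq[OF e2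
        exec_seq[OF s'(1) e3]]]]) (use n sF s'(4) sizes in \<open>auto simp: b_def s0_def\<close>)
  qed auto
  then show ?thesis unfolding ptime_def F_def by blast
qed

text \<open>Programs have no closures, so whatever the loop body refers to besides the element and
  the accumulator travels through \<open>env\<close>.\<close>

lemma ptime_fold:
  assumes "ptime (\<lambda>u. step (left_of u) (left_of (right_of u)) (right_of (right_of u)))"
    and "\<And>e x a. tree_size (step e x a) \<le> tree_size a + poly q (tree_size e + tree_size x)"
    and "ptime env" "ptime l" "ptime a"
  shows "ptime (\<lambda>t. fold (step (env t)) (elems (l t)) (a t))"
  using ptime_comp[OF ptime_fold_tree[OF assms(1), of q] ptime_Node[OF assms(3)
    ptime_Node[OF assms(4,5)]]] assms(2)
  by simp

section \<open>Predicates and finitely listed sets\<close>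

lemma ptime_pred_eq:
  assumes "ptime f" "ptime g"
  shows "ptime_pred (\<lambda>t. f t = g t)"
proof -
  have "ptime (\<lambda>u. tree_of_bool (left_of u = right_of u))"
  proof (rule ptime_assign)
    show "expr_val (EEq (ELeft (EVar 0)) (ERight (EVar 0))) s =
        tree_of_bool (left_of (s 0) = right_of (s 0))" for s
      by simp
    show "expr_cost (EEq (ELeft (EVar 0)) (ERight (EVar 0))) s \<le> 4 * tree_size (s 0) + 3" for s
      using left_size[of "s 0"] right_size[of "s 0"]
        tree_size_of_bool[of "left_of (s 0) = right_of (s 0)"] by simp
    show "poly_bounded (\<lambda>t. 4 * tree_size t + 3)" by (intro poly_bounded_intros)
  qed
  from ptime_comp[OF this ptime_Node[OF assms]] show ?thesis
    by (simp add: ptime_pred_def)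
qed

lemma ptime_bool: "ptime (\<lambda>t. tree_of_bool b)"
  by (cases b) (auto simp: tree_of_bool_def intro: ptime_Node ptime_Leaf)

lemma ptime_pred_not:
  assumes "ptime_pred P"
  shows "ptime_pred (\<lambda>t. \<not> P t)"
proof -
  have "(\<lambda>t. tree_of_bool (\<not> P t)) = (\<lambda>t. if P t then tree_of_bool False else tree_of_bool True)"
    by auto
  then show ?thesis
    using ptime_if[OF assms ptime_bool ptime_bool] by (simp only: ptime_pred_def)
qed

lemma ptime_pred_conj:
  assumes "ptime_pred P" "ptime_pred Q"
  shows "ptime_pred (\<lambda>t. P t \<and> Q t)"
proof -
  have "(\<lambda>t. tree_of_bool (P t \<and> Q t)) = (\<lambda>t. if P t then tree_of_bool (Q t) else tree_of_bool False)"
    by auto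
  then show ?thesis
    using ptime_if[OF assms(1) assms(2)[unfolded ptime_pred_def] ptime_bool]
    by (simp only: ptime_pred_def)
qed

text \<open>Order and repetitions of the list are left open, so a union is a concatenation and
  duplicates never have to be removed.\<close>

definition ptime_set :: "(tree \<Rightarrow> tree set) \<Rightarrow> bool" where
  "ptime_set S \<longleftrightarrow> (\<exists>f. ptime f \<and> (\<forall>t. set (elems (f t)) = S t))"

lemma ptime_set_elems: "ptime f \<Longrightarrow> ptime_set (\<lambda>t. set (elems (f t)))"
  unfolding ptime_set_def by blast

lemma ptime_set_empty: "ptime_set (\<lambda>t. {})"
  unfolding ptime_set_def by (rule exI[of _ "\<lambda>_. Leaf"]) (simp add: ptime_Leaf)

lemma ptime_set_insert:
  assumes "ptime f" "ptime_set S"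
  shows "ptime_set (\<lambda>t. insert (f t) (S t))"
proof -
  obtain g where "ptime g" "\<And>t. set (elems (g t)) = S t"
    using assms(2) unfolding ptime_set_def by blast
  with assms(1) show ?thesis
    unfolding ptime_set_def by (intro exI[of _ "\<lambda>t. Node (f t) (g t)"]) (simp add: ptime_Node)
qed

lemma ptime_set_filter:
  assumes "ptime_pred P" "ptime_set S"
  shows "ptime_set (\<lambda>t. if P t then S t else {})"
proof -
  obtain g where "ptime g" "\<And>t. set (elems (g t)) = S t"
    using assms(2) unfolding ptime_set_def by blast
  with assms(1) show ?thesis
    unfolding ptime_set_def
    by (intro exI[of _ "\<lambda>t. if P t then g t else Leaf"]) (simp add: ptime_if ptime_Leaf)
qed

text \<open>The loop accumulates the truth value found so far. The bound variable is paired with the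
  parameters in one tree, so nested quantifiers become nested pairs and their bodies can again refer
  to everything by projections.\<close>

lemma ptime_pred_bex:
  assumes "ptime_set S" "ptime_pred (\<lambda>u. P (left_of u) (right_of u))"
  shows "ptime_pred (\<lambda>t. \<exists>x\<in>S t. P t x)"
proof -
  obtain f where f: "ptime f" "\<And>t. set (elems (f t)) = S t"
    using assms(1) unfolding ptime_set_def by blast
  define step where "step = (\<lambda>e x a. if P e x then tree_of_bool True else a)"
  have "fold (step t) xs (tree_of_bool b) = tree_of_bool ((\<exists>x\<in>set xs. P t x) \<or> b)" for t xs b
    by (induction xs arbitrary: b) (auto simp: step_def)
  from this[of _ _ False] have eq: "tree_of_bool (\<exists>x\<in>S t. P t x) = fold (step t) (elems (f t)) Leaf" for t
    by (simp add: f(2) tree_of_bool_def)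
  have "ptime_pred (\<lambda>u. P (left_of u) (left_of (right_of u)))"
    using ptime_comp[OF assms(2)[unfolded ptime_pred_def] ptime_Node[OF ptime_left[OF ptime_id]
      ptime_left[OF ptime_right[OF ptime_id]]]]
    by (simp add: ptime_pred_def)
  then have "ptime (\<lambda>u. step (left_of u) (left_of (right_of u)) (right_of (right_of u)))"
    unfolding step_def
    by (intro ptime_if ptime_bool ptime_right ptime_id)
  moreover have "tree_size (step e x a) \<le> tree_size a + poly [:3:] (tree_size e + tree_size x)"
    for e x a by (simp add: step_def tree_of_bool_def)
  ultimately show ?thesis
    unfolding ptime_pred_def eq by (rule ptime_fold) (intro ptime_id ptime_Leaf f)+
qed

lemma ptime_pred_mem: "ptime f \<Longrightarrow> ptime_set S \<Longrightarrow> ptime_pred (\<lambda>t. f t \<in> S t)"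
  using ptime_pred_bex[of S "\<lambda>t x. f t = x"] ptime_pred_eq[of "\<lambda>u. f (left_of u)" right_of]
    ptime_comp[OF _ ptime_left[OF ptime_id], of f] ptime_right[OF ptime_id]
  by simp

text \<open>The first list ends up reversed, which is harmless for sets and allows a single
  loop.\<close>

definition append_tree :: "tree \<Rightarrow> tree \<Rightarrow> tree" where
  "append_tree s t = fold Node (elems s) t"

lemma set_append_tree [simp]: "set (elems (append_tree s t)) = set (elems s) \<union> set (elems t)"
  unfolding append_tree_def by (induction s arbitrary: t) auto

lemma size_append_tree: "tree_size (append_tree s t) \<le> tree_size s + tree_size t"
  unfolding append_tree_def
proof (induction s arbitrary: t)
  case (Node s1 s2)
  show ?case using Node(2)[of "Node s1 t"] by simp
qed simp

lemma ptime_append_tree: "ptime f \<Longrightarrow> ptime g \<Longrightarrow> ptime (\<lambda>t. append_tree (f t) (g t))"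
  unfolding append_tree_def
proof (rule ptime_fold[where q = "[:1, 1:]" and env = "\<lambda>t. t" and step = "\<lambda>_. Node"])
  show "ptime (\<lambda>u. Node (left_of (right_of u)) (right_of (right_of u)))"
    by (intro ptime_Node ptime_left ptime_right ptime_id)
qed (auto intro: ptime_id)

text \<open>Each round adds a list computed from the parameter and the element alone, so the growth
  does not depend on the accumulator; \<open>pcompose p [:1, 1:]\<close> accounts for the node that
  pairs the two.\<close>

lemma ptime_set_UN:
  assumes "ptime_set S" "ptime_set (\<lambda>u. T (left_of u) (right_of u))"
  shows "ptime_set (\<lambda>t. \<Union>x\<in>S t. T t x)"
proof -
  obtain f where f: "ptime f" "\<And>t. set (elems (f t)) = S t"
    using assms(1) unfolding ptime_set_def by blast
  obtain g where g: "ptime g" "\<And>u. set (elems (g u)) = T (left_of u) (right_of u)"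
    using assms(2) unfolding ptime_set_def by blast
  define step where "step = (\<lambda>e x. append_tree (g (Node e x)))"
  have eq: "set (elems (fold (step t) xs a)) = (\<Union>x\<in>set xs. T t x) \<union> set (elems a)" for t xs a
    by (induction xs arbitrary: a) (auto simp: step_def g(2))
  obtain p where p: "\<And>t. tree_size (g t) \<le> poly p (tree_size t)"
    using ptime_size[OF g(1)] unfolding poly_bounded_def by blast
  have "ptime (\<lambda>u. step (left_of u) (left_of (right_of u)) (right_of (right_of u)))"
    unfolding step_def
    by (intro ptime_append_tree ptime_comp[OF g(1)] ptime_Node ptime_left ptime_right ptime_id)
  moreover have "tree_size (step e x a) \<le>
      tree_size a + poly (pcompose p [:1, 1:]) (tree_size e + tree_size x)" for e x a
    using size_append_tree[of "g (Node e x)" a] p[of "Node e x"]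
    by (simp add: step_def poly_pcompose)
  ultimately have "ptime (\<lambda>t. fold (step t) (elems (f t)) Leaf)"
    by (rule ptime_fold) (intro ptime_id ptime_Leaf f)+
  then show ?thesis
    unfolding ptime_set_def
    by (rule_tac x = "\<lambda>t. fold (step t) (elems (f t)) Leaf" in exI) (simp add: eq f(2))
qed

lemma ptime_set_Un:
  assumes "ptime_set S" "ptime_set T"
  shows "ptime_set (\<lambda>t. S t \<union> T t)"
proof -
  obtain f g where "ptime f" "\<And>t. set (elems (f t)) = S t" "ptime g" "\<And>t. set (elems (g t)) = T t"
    using assms unfolding ptime_set_def by blast
  then show ?thesis
    unfolding ptime_set_def
    by (intro exI[of _ "\<lambda>t. append_tree (f t) (g t)"]) (simp add: ptime_append_tree)
qed

section \<open>Reachability in a listed graph\<close>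

definition graph_of :: "tree set \<Rightarrow> (tree \<times> tree) set" where
  "graph_of E = (\<lambda>e. (left_of e, right_of e)) ` E"

text \<open>A reachable vertex needs at most \<open>card R\<close> edges, and a list of the edges is
  at least that long. Asking only for inclusions admits rounds that update the set in place and may,
  depending on the order of the list, follow several edges at once.\<close>

lemma rtrancl_Image_by_rounds:
  assumes "set ps = R"
    and step: "\<And>A. f A \<subseteq> R\<^sup>* `` A" "\<And>A. R `` A \<subseteq> f A" "\<And>A. A \<subseteq> f A"
    and "n \<ge> length ps"
  shows "(f ^^ n) S = R\<^sup>* `` S"
proof
  show "(f ^^ n) S \<subseteq> R\<^sup>* `` S"
  proof (induction n)
    case (Suc n)
    have "f ((f ^^ n) S) \<subseteq> R\<^sup>* `` (R\<^sup>* `` S)"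
      using step(1)[of "(f ^^ n) S"] Suc by blast
    also have "\<dots> = R\<^sup>* `` S" by (simp flip: relcomp_Image)
    finally show ?case by simp
  qed auto
  have mono: "(f ^^ i) S \<subseteq> (f ^^ (i + j)) S" for i j
    by (induction j) (use step(3) in auto)
  have rel: "(R ^^ i) `` S \<subseteq> (f ^^ i) S" for i
  proof (induction i)
    case (Suc i)
    have "(R ^^ Suc i) `` S \<subseteq> R `` ((f ^^ i) S)" using Suc by auto
    also have "\<dots> \<subseteq> f ((f ^^ i) S)" by (rule step(2))
    finally show ?case by simp
  qed auto
  have "finite R" using assms(1) by auto
  then have "R\<^sup>* = (\<Union>i\<in>{..card R}. R ^^ i)"
    using rtrancl_finite_eq_relpow[of R] by auto
  moreover have "(R ^^ i) `` S \<subseteq> (f ^^ n) S" if "i \<le> card R" for i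
  proof -
    have "i \<le> n" using that card_length[of ps] assms(1,5) by simp
    then show ?thesis using rel[of i] mono[of i "n - i"] by simp
  qed
  ultimately show "R\<^sup>* `` S \<subseteq> (f ^^ n) S" by blast
qed

text \<open>A target may be added repeatedly. Polynomial growth is still guaranteed, because one
  pass over the edges adds at most the size of the edge list.\<close>

definition close_step :: "tree \<Rightarrow> tree \<Rightarrow> tree" where
  "close_step e A = (if left_of e \<in> set (elems A) then Node (right_of e) A else A)"

text \<open>Two nested loops over the same list: the inner one is a pass over the edges, while the
  outer one uses the list only as a counter for the number of passes.\<close>

lemma ptime_set_rtrancl:
  assumes "ptime_set E" "ptime_set S"
  shows "ptime_set (\<lambda>t. (graph_of (E t))\<^sup>* `` S t)"
proof -
  obtain f where f: "ptime f" "\<And>t. set (elems (f t)) = E t"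
    using assms(1) unfolding ptime_set_def by blast
  obtain g where g: "ptime g" "\<And>t. set (elems (g t)) = S t"
    using assms(2) unfolding ptime_set_def by blast
  define pass where "pass = (\<lambda>E A. fold close_step (elems E) A)"
  have "ptime (\<lambda>u. close_step (left_of (right_of u)) (right_of (right_of u)))"
    unfolding close_step_def
    by (intro ptime_if ptime_pred_mem ptime_set_elems ptime_Node ptime_left ptime_right ptime_id)
  moreover have close_size: "tree_size (close_step e A) \<le> tree_size A + (1 + tree_size e)" for e A
    using right_size[of e] by (auto simp: close_step_def)
  then have "tree_size (close_step x A) \<le> tree_size A + poly [:1, 1:] (tree_size e + tree_size x)"
    for e x A by (rule le_trans) simp
  ultimately have pass: "ptime h \<Longrightarrow> ptime h' \<Longrightarrow> ptime (\<lambda>t. pass (h t) (h' t))" for h h'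
    unfolding pass_def
    by (rule ptime_fold[where step = "\<lambda>_. close_step" and env = "\<lambda>t. t"]) (auto intro: ptime_id)
  have pass_size: "tree_size (pass E A) \<le> tree_size A + tree_size E" for E A
    unfolding pass_def
  proof (induction E arbitrary: A)
    case (Node e E)
    show ?case using Node(2)[of "close_step e A"] close_size[of e A] by simp
  qed simp
  have "ptime (\<lambda>t. fold (\<lambda>_. pass (f t)) (elems (f t)) (g t))"
  proof (rule ptime_fold[where step = "\<lambda>E _. pass E" and q = "[:0, 1:]"])
    show "ptime (\<lambda>u. pass (left_of u) (right_of (right_of u)))"
      by (intro pass ptime_left ptime_right ptime_id)
    show "tree_size (pass e a) \<le> tree_size a + poly [:0, 1:] (tree_size e + tree_size x)"
      for e x a by (rule le_trans[OF pass_size]) simp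
  qed (intro f g)+
  moreover have "set (elems (fold (\<lambda>_. pass E) (elems E) A)) =
      (graph_of (set (elems E)))\<^sup>* `` set (elems A)" for E A
  proof -
    let ?es = "\<lambda>E. map (\<lambda>e. (left_of e, right_of e)) (elems E)"
    define F where "F = (\<lambda>A. fold (\<lambda>(x, y) A. if x \<in> A then insert y A else A) (?es E) (A :: tree set))"
    have set_pass: "set (elems (pass E A)) = F (set (elems A))" for A
      unfolding pass_def F_def
      by (induction E arbitrary: A) (auto simp: close_step_def)
    have rounds: "set (elems (fold (\<lambda>_. pass E) xs A)) = (F ^^ length xs) (set (elems A))" for xs A
      by (induction xs arbitrary: A) (auto simp: set_pass funpow_swap1)
    have "(F ^^ length (elems E)) (set (elems A)) =
        (graph_of (set (elems E)))\<^sup>* `` set (elems A)"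
    proof (rule rtrancl_Image_by_rounds[where ps = "?es E"])
      fix A :: "tree set"
      show "F A \<subseteq> (graph_of (set (elems E)))\<^sup>* `` A"
      proof -
        \<comment> \<open>The set \<open>A\<close> changes during a pass while the claim is about
          the set at its beginning, so the invariant relates \<open>A\<close> to a separate fixed
          set \<open>B\<close>.\<close>
        have *: "fold (\<lambda>(x, y) A. if x \<in> A then insert y A else A) ps A \<subseteq> R\<^sup>* `` B"
          if "set ps \<subseteq> R" "A \<subseteq> R\<^sup>* `` B" for ps and R :: "(tree \<times> tree) set" and A B
          using that
        proof (induction ps arbitrary: A)
          case (Cons p ps)
          obtain x y where p: "p = (x, y)" by (cases p)
          have "(x, y) \<in> R" using Cons.prems(1) p by simp
          then have "y \<in> R\<^sup>* `` B" if "x \<in> R\<^sup>* `` B"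
            using that by (blast intro: rtrancl_into_rtrancl)
          then have "(if x \<in> A then insert y A else A) \<subseteq> R\<^sup>* `` B"
            using Cons.prems(2) by (simp add: subset_iff)
          with Cons.IH Cons.prems(1) show ?case by (simp add: p)
        qed simp
        show ?thesis unfolding F_def by (rule *) (auto simp: graph_of_def)
      qed
      have mono: "A \<subseteq> fold (\<lambda>(x, y) A. if x \<in> A then insert y A else A) ps A"
        for ps and A :: "tree set"
      proof (induction ps arbitrary: A)
        case (Cons p ps)
        obtain x y where p: "p = (x, y)" by (cases p)
        have "A \<subseteq> (if x \<in> A then insert y A else A)" by auto
        also note Cons
        finally show ?case by (simp add: p)
      qed simp
      then show "A \<subseteq> F A" unfolding F_def .
      have "set ps `` A \<subseteq> fold (\<lambda>(x, y) A. if x \<in> A then insert y A else A) ps A"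
        for ps and A :: "tree set"
      proof (induction ps arbitrary: A)
        case (Cons p ps)
        obtain x y where [simp]: "p = (x, y)" by (cases p)
        have "set ps `` (insert y A) \<subseteq> fold (\<lambda>(x, y) A. if x \<in> A then insert y A else A) ps (insert y A)"
          "set ps `` A \<subseteq> fold (\<lambda>(x, y) A. if x \<in> A then insert y A else A) ps A"
          by (rule Cons)+
        then show ?case using mono[of "insert y A" ps] by (auto 0 3)
      qed simp
      from this[of "?es E" A] show "graph_of (set (elems E)) `` A \<subseteq> F A"
        unfolding F_def graph_of_def by simp
    qed (auto simp: graph_of_def)
    then show ?thesis by (rule trans[OF rounds])
  qed
  ultimately show ?thesis
    unfolding ptime_set_def
    by (rule_tac x = "\<lambda>t. fold (\<lambda>_. pass (f t)) (elems (f t)) (g t)" in exI) (simp add: f(2) g(2))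
qed

lemmas ptime_intros = ptime_id ptime_Leaf ptime_left ptime_right ptime_Node
  ptime_pred_eq ptime_pred_not ptime_pred_conj ptime_pred_bex ptime_pred_mem
  ptime_set_elems ptime_set_empty ptime_set_insert ptime_set_filter ptime_set_UN ptime_set_Un
  ptime_set_rtrancl

lemma polytime_decidableI:
  assumes "ptime_pred P" "\<And>x t. x \<in> Inst \<Longrightarrow> Enc x t \<Longrightarrow> P t \<longleftrightarrow> Q x"
  shows "polytime_decidable Enc Inst Q"
proof -
  obtain c k g where c: "computes c k g (\<lambda>t. tree_of_bool (P t))"
    using assms(1) unfolding ptime_pred_def ptime_def by blast
  then obtain p where p: "\<And>t. g t \<le> poly p (tree_size t)"
    using computes_bounded unfolding poly_bounded_def by blast
  have "\<exists>n s'. exec c (input_store t) n s' \<and> n \<le> poly p (tree_size t) \<and> (s' 0 \<noteq> Leaf \<longleftrightarrow> Q x)"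
    if "x \<in> Inst" "Enc x t" for x t
  proof -
    obtain n s' where "exec c (input_store t) n s'" "n \<le> g t" "s' 0 = tree_of_bool (P t)"
      by (rule computesE[OF c, of "input_store t"]) (simp add: input_store_def)
    moreover from this have "n \<le> poly p (tree_size t)" using p[of t] by linarith
    ultimately have "exec c (input_store t) n s' \<and> n \<le> poly p (tree_size t) \<and> (s' 0 \<noteq> Leaf \<longleftrightarrow> Q x)"
      using assms(2)[OF that] by simp
    then show ?thesis by blast
  qed
  then show ?thesis unfolding polytime_decidable_def by blast
qed

section \<open>Phases\<close>

fun phases :: "nat \<Rightarrow> 'a label list \<Rightarrow> ('a label \<times> nat) list" where
  "phases n [] = []"
| "phases n (Bullet # w) = phases (Suc n) w"
| "phases n (Action a # w) = (Action a, n) # phases n w"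

abbreviation bullets :: "'a label list \<Rightarrow> nat" where
  "bullets w \<equiv> count_list w Bullet"

type_synonym 'a phased = "'a label idx \<times> nat"

definition thread_phases :: "nat \<Rightarrow> 'a phased list \<Rightarrow> ('a label \<times> nat) list" where
  "thread_phases i \<sigma> = map (\<lambda>((a, j), k). (a, k)) (filter (\<lambda>x. snd (fst x) = i) \<sigma>)"

lemma thread_phases_simps [simp]:
  "thread_phases i [] = []"
  "thread_phases i (((a, j), k) # \<sigma>) = (if j = i then (a, k) # thread_phases i \<sigma> else thread_phases i \<sigma>)"
  "thread_phases i (\<sigma> @ \<sigma>') = thread_phases i \<sigma> @ thread_phases i \<sigma>'"
  by (auto simp: thread_phases_def)

lemma thread_word_simps [simp]:
  "thread_word i [] = []"
  "thread_word i ((a, j) # \<tau>) = (if j = i then a # thread_word i \<tau> else thread_word i \<tau>)"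
  "thread_word i (\<tau> @ \<tau>') = thread_word i \<tau> @ thread_word i \<tau>'"
  by (auto simp: thread_word_def)

lemma restrict_word_simps [simp]:
  "restrict_word Z [] = []"
  "restrict_word Z (x # \<tau>) = (if x \<in> Z then x # restrict_word Z \<tau> else restrict_word Z \<tau>)"
  "restrict_word Z (\<tau> @ \<tau>') = restrict_word Z \<tau> @ restrict_word Z \<tau>'"
  by (auto simp: restrict_word_def)

lemma in_Act_simps [simp]: "Action a \<in> Act" "Bullet \<notin> Act" "(b, i) \<in> Idx A \<longleftrightarrow> b \<in> A"
  by (auto simp: Act_def Idx_def)

lemma Act_Un_Bullet [simp]: "Act \<union> {Bullet} = UNIV"
proof -
  have "x \<in> Act \<union> {Bullet}" for x :: "'a label" by (cases x) auto
  then show ?thesis by blast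
qed

lemma map_fst_phases: "map fst (phases n w) = restrict_word Act w"
  by (induction n w rule: phases.induct) auto

lemma phases_lower: "x \<in> set (phases n w) \<Longrightarrow> n \<le> snd x"
  by (induction n w rule: phases.induct) auto

lemma phases_upper: "x \<in> set (phases n w) \<Longrightarrow> snd x \<le> n + bullets w"
  by (induction n w rule: phases.induct) auto

lemma sorted_phases: "sorted (map snd (phases n w))"
  by (induction n w rule: phases.induct) (auto dest: phases_lower)

lemma ex_split_Cons:
  "(\<exists>u v. c # w = u @ b # v \<and> P u) \<longleftrightarrow> c = b \<and> P [] \<or> (\<exists>u v. w = u @ b # v \<and> P (c # u))"
proof
  assume "\<exists>u v. c # w = u @ b # v \<and> P u"
  then obtain u v where "c # w = u @ b # v" "P u" by blast
  then show "c = b \<and> P [] \<or> (\<exists>u v. w = u @ b # v \<and> P (c # u))" by (cases u) auto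
next
  assume "c = b \<and> P [] \<or> (\<exists>u v. w = u @ b # v \<and> P (c # u))"
  then show "\<exists>u v. c # w = u @ b # v \<and> P u" by (metis append_Cons append_Nil)
qed

text \<open>Turns an annotation into a split of the word, the form in which it can be compared with
  paths.\<close>

lemma in_phases_iff:
  "(b, k) \<in> set (phases n w) \<longleftrightarrow> b \<in> Act \<and> (\<exists>u v. w = u @ b # v \<and> k = n + bullets u)"
proof (induction n w rule: phases.induct)
  case (2 n w)
  then show ?case unfolding ex_split_Cons by auto
next
  case (3 n a w)
  then show ?case unfolding ex_split_Cons by auto
qed simp

lemma thread_word_map_fst: "thread_word i (map fst \<sigma>) = map fst (thread_phases i \<sigma>)"
  by (induction \<sigma>) auto

text \<open>Annotations of different threads do not interact, so they can be merged in the order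
  that \<open>\<tau>\<close> prescribes.\<close>

lemma ex_phased:
  assumes "\<And>i. thread_word i \<tau> = map fst (f i)"
  shows "\<exists>\<sigma>. map fst \<sigma> = \<tau> \<and> (\<forall>i. thread_phases i \<sigma> = f i)"
  using assms
proof (induction \<tau> arbitrary: f)
  case Nil
  then show ?case by (intro exI[of _ "[]"]) auto
next
  case (Cons x \<tau>)
  obtain a i where x: "x = (a, i)" by (cases x)
  obtain k r where f: "f i = (a, k) # r" "thread_word i \<tau> = map fst r"
    using Cons.prems[of i] x by auto
  have "thread_word j \<tau> = map fst ((f(i := r)) j)" for j
    using Cons.prems[of j] f x by auto
  from Cons.IH[OF this] obtain \<sigma> where "map fst \<sigma> = \<tau>" "\<forall>j. thread_phases j \<sigma> = (f(i := r)) j"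
    by blast
  then show ?case
    using f by (intro exI[of _ "((a, i), k) # \<sigma>"]) (auto simp: x)
qed

text \<open>A position is determined by its thread and its rank within that thread, so annotating
  the threads leaves no freedom. This identifies an annotation carried along swaps with one read off
  a word with sync-points.\<close>

lemma phased_unique:
  assumes "map fst \<sigma> = map fst \<sigma>'" "\<And>i. thread_phases i \<sigma> = thread_phases i \<sigma>'"
  shows "\<sigma> = \<sigma>'"
  using assms
proof (induction \<sigma> arbitrary: \<sigma>')
  case (Cons x \<sigma>)
  obtain a i k where x: "x = ((a, i), k)" by (metis prod.collapse)
  obtain k' r where s: "\<sigma>' = ((a, i), k') # r" using Cons.prems(1) x by auto
  have k: "k = k'" using Cons.prems(2)[of i] x s by simp
  have "\<sigma> = r"
  proof (rule Cons.IH)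
    show "thread_phases j \<sigma> = thread_phases j r" for j
      using Cons.prems(2)[of j] x s by (auto split: if_splits)
  qed (use Cons.prems(1) s in simp)
  with k s x show ?case by simp
qed auto

section \<open>Swaps and sorting by phase\<close>

lemma swap_order_Cons:
  assumes "swap_order I \<tau> \<tau>'" "x \<in> Idx Act"
  shows "swap_order I (x # \<tau>) (x # \<tau>')"
  using assms
proof (induction rule: swap_order.induct)
  case (swap_refl \<tau>)
  then show ?case by (intro swap_order.swap_refl) auto
next
  case (swap_step \<rho> \<sigma> a b i j)
  then show ?case using swap_order.swap_step[of "x # \<rho>" \<sigma> a b I i j] by simp
qed (auto intro: swap_order.intros(1,2))

text \<open>On its way to the right \<open>x\<close> passes only entries with a strictly smaller
  key, each by one swap, and stops at the first other entry.\<close>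

lemma swap_order_insort:
  assumes "fst ` insert x (set xs) \<subseteq> Idx Act"
    and "\<And>y. y \<in> set xs \<Longrightarrow> snd y < snd x \<Longrightarrow>
      (fst (fst x), fst (fst y)) \<in> I \<and> snd (fst x) \<noteq> snd (fst y)"
  shows "swap_order I (map fst (x # xs)) (map fst (insort_key snd x xs))"
  using assms
proof (induction xs)
  case (Cons y xs)
  show ?case
  proof (cases "snd x \<le> snd y")
    case False
    have "swap_order I ([] @ [fst x, fst y] @ map fst xs) ([] @ [fst y, fst x] @ map fst xs)"
      using Cons.prems(1) Cons.prems(2)[of y] False
        swap_step[of "[]" "map fst xs" "fst (fst x)" "fst (fst y)" I "snd (fst x)" "snd (fst y)"]
      by (auto simp: Idx_def lists_eq_set)
    moreover have "swap_order I (fst y # map fst (x # xs)) (fst y # map fst (insort_key snd x xs))"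
      by (rule swap_order_Cons[OF Cons.IH]) (use Cons.prems in auto)
    ultimately show ?thesis using False by (auto intro: swap_trans)
  next
    case True
    have "map fst (x # y # xs) \<in> lists (Idx Act)" using Cons.prems(1) by auto
    then show ?thesis using True by (simp add: swap_refl)
  qed
qed (auto intro!: swap_refl)

text \<open>\<open>sort_key\<close> is insertion sort from the right end: what \<open>x\<close>
  passes in the sorted rest also followed it in \<sigma>, so the hypothesis on ordered pairs of
  \<sigma> covers every swap.\<close>

lemma swap_order_sort:
  assumes "fst ` set \<sigma> \<subseteq> Idx Act"
    and "sorted_wrt (\<lambda>x y. snd y < snd x \<longrightarrow>
      (fst (fst x), fst (fst y)) \<in> I \<and> snd (fst x) \<noteq> snd (fst y)) \<sigma>"
  shows "swap_order I (map fst \<sigma>) (map fst (sort_key snd \<sigma>))"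
  using assms
proof (induction \<sigma>)
  case (Cons x \<sigma>)
  have "swap_order I (fst x # map fst \<sigma>) (fst x # map fst (sort_key snd \<sigma>))"
    by (rule swap_order_Cons) (use Cons in auto)
  moreover have "swap_order I (map fst (x # sort_key snd \<sigma>)) (map fst (insort_key snd x (sort_key snd \<sigma>)))"
    by (rule swap_order_insort) (use Cons.prems in auto)
  ultimately show ?case by (auto intro: swap_trans)
qed (auto intro!: swap_refl)

text \<open>\<open>\<not> sorted_wrt (\<lambda>u v. \<not> (u = x \<and> v = y)) \<sigma>\<close> says that some
  occurrence of \<open>x\<close> in \<open>\<sigma>\<close> precedes one of \<open>y\<close>.\<close>

lemma swap_order_lift:
  assumes "swap_order I \<tau> \<tau>'" "map fst \<sigma> = \<tau>"
  shows "\<exists>\<sigma>'. map fst \<sigma>' = \<tau>' \<and> (\<forall>i. thread_phases i \<sigma>' = thread_phases i \<sigma>) \<and>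
    (\<forall>x y. (fst (fst x), fst (fst y)) \<notin> I \<longrightarrow>
      \<not> sorted_wrt (\<lambda>u v. \<not> (u = x \<and> v = y)) \<sigma> \<longrightarrow> \<not> sorted_wrt (\<lambda>u v. \<not> (u = x \<and> v = y)) \<sigma>')"
  using assms
proof (induction arbitrary: \<sigma> rule: swap_order.induct)
  case (swap_refl \<tau>)
  then show ?case by blast
next
  case (swap_trans \<tau>1 \<tau>2 \<tau>3)
  obtain \<sigma>2 where 2: "map fst \<sigma>2 = \<tau>2" "\<And>i. thread_phases i \<sigma>2 = thread_phases i \<sigma>"
    "\<And>x y. (fst (fst x), fst (fst y)) \<notin> I \<Longrightarrow>
      \<not> sorted_wrt (\<lambda>u v. \<not> (u = x \<and> v = y)) \<sigma> \<Longrightarrow> \<not> sorted_wrt (\<lambda>u v. \<not> (u = x \<and> v = y)) \<sigma>2"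
    using swap_trans.IH(1)[OF swap_trans.prems] by blast
  obtain \<sigma>3 where 3: "map fst \<sigma>3 = \<tau>3" "\<And>i. thread_phases i \<sigma>3 = thread_phases i \<sigma>2"
    "\<And>x y. (fst (fst x), fst (fst y)) \<notin> I \<Longrightarrow>
      \<not> sorted_wrt (\<lambda>u v. \<not> (u = x \<and> v = y)) \<sigma>2 \<Longrightarrow> \<not> sorted_wrt (\<lambda>u v. \<not> (u = x \<and> v = y)) \<sigma>3"
    using swap_trans.IH(2)[OF 2(1)] by blast
  show ?case
    by (rule exI[of _ \<sigma>3]) (use 2 3 in simp)
next
  case (swap_step \<rho> \<tau> a b i j)
  then obtain \<sigma>1 k l \<sigma>2 where s: "\<sigma> = \<sigma>1 @ [((a, i), k), ((b, j), l)] @ \<sigma>2"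
    "map fst \<sigma>1 = \<rho>" "map fst \<sigma>2 = \<tau>"
    by (auto simp: map_eq_append_conv)
  \<comment> \<open>Phases travel with their letters. The two letters belong to different threads,
    so no thread sees a change, and the only order destroyed is that of a pair whose actions are in
    \<open>I\<close>.\<close>
  show ?case
    by (rule exI[of _ "\<sigma>1 @ [((b, j), l), ((a, i), k)] @ \<sigma>2"])
      (use s swap_step.hyps in \<open>auto simp: sorted_wrt_append\<close>)
qed

section \<open>Interleavings with sync-points and their phases\<close>

fun phase_word :: "(nat \<Rightarrow> nat) \<Rightarrow> 'a label idx list \<Rightarrow> 'a phased list" where
  "phase_word c [] = []"
| "phase_word c ((Bullet, i) # \<tau>) = phase_word (c(i := Suc (c i))) \<tau>"
| "phase_word c ((Action a, i) # \<tau>) = ((Action a, i), c i) # phase_word c \<tau>"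

lemma map_fst_phase_word: "map fst (phase_word c \<tau>) = restrict_word (Idx Act) \<tau>"
  by (induction c \<tau> rule: phase_word.induct) (auto simp: fun_upd_def)

lemma thread_phases_phase_word: "thread_phases i (phase_word c \<tau>) = phases (c i) (thread_word i \<tau>)"
  by (induction c \<tau> rule: phase_word.induct) (auto simp: fun_upd_def)

lemma phase_word_append:
  "phase_word c (u @ v) = phase_word c u @ phase_word (\<lambda>i. c i + bullets (thread_word i u)) v"
proof (induction c u rule: phase_word.induct)
  case (2 c i \<tau>)
  have "(\<lambda>ia. (c(i := Suc (c i))) ia + bullets (thread_word ia \<tau>)) =
      (\<lambda>ia. c ia + bullets (thread_word ia ((Bullet, i) # \<tau>)))" by auto
  with 2 show ?case by (simp add: fun_upd_def)
next
  case (3 c a i \<tau>)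
  have "(\<lambda>ia. c ia + bullets (thread_word ia \<tau>)) =
      (\<lambda>ia. c ia + bullets (thread_word ia ((Action a, i) # \<tau>)))" by auto
  with 3 show ?case by simp
qed auto

lemma phase_word_actions:
  assumes "u \<in> lists (Act \<times> T)" "\<forall>i\<in>T. c i = n"
  shows "set (map snd (phase_word c u)) \<subseteq> {n}" "bullets (thread_word i u) = 0"
proof -
  have "set (map snd (phase_word c u)) \<subseteq> {n} \<and> bullets (thread_word i u) = 0"
    using assms by (induction c u rule: phase_word.induct) (auto simp: fun_upd_def)
  then show "set (map snd (phase_word c u)) \<subseteq> {n}" "bullets (thread_word i u) = 0" by auto
qed

lemma thread_word_sync_word:
  "finite T \<Longrightarrow> thread_word i (sync_word T) = (if i \<in> T then [Bullet] else [])"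
proof -
  have "distinct ts \<Longrightarrow> thread_word i (map (Pair Bullet) ts) = (if i \<in> set ts then [Bullet :: 'a label] else [])" for ts
    by (induction ts) auto
  from this[of "sorted_list_of_set T"] show "finite T \<Longrightarrow> ?thesis" by (simp add: sync_word_def)
qed

lemma restrict_sync_word [simp]: "restrict_word (Idx Act) (sync_word T) = []"
  by (simp add: sync_word_def restrict_word_def)

lemma phase_word_sync_word [simp]: "phase_word c (sync_word T) = []"
  using map_fst_phase_word[of c "sync_word T"] by simp

lemma sorted_const: "set xs \<subseteq> {n} \<Longrightarrow> sorted xs"
  by (induction xs) auto

text \<open>The threads of \<open>T\<close> share the counter value \<open>n\<close>: a block of
  actions keeps it and emits letters of phase \<open>n\<close>, a sync-word raises it for all of
  \<open>T\<close> at once, and threads that drop out emit nothing more. The lower bound is carried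
  along to glue sorted pieces together.\<close>

lemma sync_on_sorted:
  assumes "sync_on T \<tau>" "\<forall>i\<in>T. c i = n"
  shows "sorted (map snd (phase_word c \<tau>)) \<and> (\<forall>x\<in>set (phase_word c \<tau>). n \<le> snd x)"
  using assms
proof (induction arbitrary: c n rule: sync_on.induct)
  case (sync_step T \<tau>1 T' \<tau>2)
  obtain bs where bs: "\<tau>1 = concat bs" "set bs \<subseteq> lists (Act \<times> T) \<union> {sync_word T}"
    using sync_step.hyps(3) by (auto simp: kstar_def lists_eq_set)
  \<comment> \<open>Sync-words raise the common counter between blocks, so \<open>c\<close> and
    \<open>n\<close> are generalized again for the induction over blocks.\<close>
  have "sorted (map snd (phase_word c (concat bs @ \<tau>2))) \<and>
      (\<forall>x\<in>set (phase_word c (concat bs @ \<tau>2)). n \<le> snd x)" if "\<forall>i\<in>T. c i = n" for c n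
    using bs(2) that
  proof (induction bs arbitrary: c n)
    case Nil
    then show ?case using sync_step.IH[of c n] sync_step.hyps(4) by auto
  next
    case (Cons b bs)
    define d where "d = (\<lambda>i. c i + bullets (thread_word i b))"
    have split: "phase_word c (concat (b # bs) @ \<tau>2) = phase_word c b @ phase_word d (concat bs @ \<tau>2)"
      using phase_word_append[of c b "concat bs @ \<tau>2"] by (simp add: d_def)
    have bs: "set bs \<subseteq> lists (Act \<times> T) \<union> {sync_word T}" using Cons.prems(1) by auto
    have "b \<in> lists (Act \<times> T) \<or> b = sync_word T" using Cons.prems(1) by auto
    then show ?case
    proof
      assume b: "b \<in> lists (Act \<times> T)"
      have "\<forall>i\<in>T. d i = n"
        using Cons.prems(2) phase_word_actions(2)[OF b Cons.prems(2)] by (simp add: d_def)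
      note rest = Cons.IH[OF bs this]
      have first: "set (map snd (phase_word c b)) \<subseteq> {n}"
        by (rule phase_word_actions(1)[OF b Cons.prems(2)])
      then have "snd x = n" if "x \<in> set (phase_word c b)" for x
        using that by (metis imageI list.set_map singletonD subsetD)
      with rest sorted_const[OF first] show ?thesis
        unfolding split by (simp add: sorted_append ball_Un)
    next
      assume b: "b = sync_word T"
      have "\<forall>i\<in>T. d i = Suc n"
        using Cons.prems(2) sync_step.hyps(1) by (simp add: d_def b thread_word_sync_word)
      from Cons.IH[OF bs this] show ?thesis unfolding split by (auto simp: b)
    qed
  qed
  then show ?case using sync_step.prems bs(1) by blast
qed simp

lemma sync_on_mono: "sync_on T' \<tau> \<Longrightarrow> T' \<subseteq> T \<Longrightarrow> finite T \<Longrightarrow> sync_on T \<tau>"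
proof (cases "T' = T")
  case False
  have "[] \<in> kstar L" for L :: "'b list set"
    unfolding kstar_def by (rule image_eqI[of _ _ "[]"]) auto
  then show "sync_on T' \<tau> \<Longrightarrow> T' \<subseteq> T \<Longrightarrow> finite T \<Longrightarrow> ?thesis"
    using sync_step[of T "[]" T' \<tau>] False by auto
qed auto

text \<open>The new block joins the outermost iteration; for \<open>T = {}\<close> every admissible
  block is empty.\<close>

lemma sync_on_prepend:
  assumes "sync_on T \<tau>" "b \<in> lists (Act \<times> T) \<or> b = sync_word T"
  shows "sync_on T (b @ \<tau>)"
  using assms(1)
proof cases
  case sync_empty
  then show ?thesis using assms by (auto simp: sync_word_def)
next
  case (sync_step \<tau>1 T' \<tau>2)
  obtain bs where bs: "\<tau>1 = concat bs" "bs \<in> lists (lists (Act \<times> T) \<union> {sync_word T})"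
    using sync_step by (auto simp: kstar_def)
  have "b @ \<tau>1 \<in> kstar (lists (Act \<times> T) \<union> {sync_word T})"
    unfolding kstar_def by (rule image_eqI[of _ _ "b # bs"]) (use bs assms(2) in auto)
  from sync_on.sync_step[OF _ _ this, of T' \<tau>2] sync_step show ?thesis by simp
qed

text \<open>A word is recovered from its annotation and its number of bullets: every phase after the
  initial one is opened by one bullet, even if it has no letters. Indices beyond the last phase
  contribute nothing, so any larger \<open>N\<close> serves, in particular one common to all
  threads.\<close>

lemma word_eq_phases:
  assumes "n + bullets w < N"
  shows "concat (map (\<lambda>k. (if n < k \<and> k \<le> n + bullets w then [Bullet] else []) @
    map fst (filter (\<lambda>x. snd x = k) (phases n w))) [n..<N]) = w"
  using assms
proof (induction n w rule: phases.induct)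
  case (1 n)
  have "(if n < k \<and> k \<le> n + bullets [] then [Bullet] else []) = ([] :: 'a label list)" for k
    by simp
  then show ?case by (auto simp: concat_eq_Nil_conv)
next
  case (2 n w)
  let ?f = "\<lambda>k. (if n < k \<and> k \<le> n + bullets (Bullet # w) then [Bullet] else []) @
    map fst (filter (\<lambda>x. snd x = k) (phases n (Bullet # w)))"
  let ?g = "\<lambda>k. (if Suc n < k \<and> k \<le> Suc n + bullets w then [Bullet] else []) @
    map fst (filter (\<lambda>x. snd x = k) (phases (Suc n) w))"
  \<comment> \<open>A leading bullet empties phase \<open>n\<close> and becomes the opening bullet
    of \<open>Suc n\<close>, which as the initial phase of \<open>?g\<close> has none.\<close>
  have "filter (\<lambda>x. snd x = n) (phases (Suc n) w) = []"
    by (auto simp: filter_empty_conv dest: phases_lower)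
  then have head: "?f n = []" "?f (Suc n) = Bullet # ?g (Suc n)" by auto
  have upt: "[n..<N] = n # Suc n # [Suc (Suc n)..<N]" "[Suc n..<N] = Suc n # [Suc (Suc n)..<N]"
    using 2(2) by (auto simp: upt_conv_Cons)
  have tail: "map ?f [Suc (Suc n)..<N] = map ?g [Suc (Suc n)..<N]" by (rule map_cong) auto
  have "concat (map ?f [n..<N]) = Bullet # concat (map ?g [Suc n..<N])"
    unfolding upt list.map concat.simps head tail by simp
  with 2 show ?case by simp
next
  case (3 n a w)
  let ?f = "\<lambda>k. (if n < k \<and> k \<le> n + bullets (Action a # w) then [Bullet] else []) @
    map fst (filter (\<lambda>x. snd x = k) (phases n (Action a # w)))"
  let ?g = "\<lambda>k. (if n < k \<and> k \<le> n + bullets w then [Bullet] else []) @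
    map fst (filter (\<lambda>x. snd x = k) (phases n w))"
  have upt: "[n..<N] = n # [Suc n..<N]" using 3(2) by (auto simp: upt_conv_Cons)
  have head: "?f n = Action a # ?g n" by simp
  have tail: "map ?f [Suc n..<N] = map ?g [Suc n..<N]" by (rule map_cong) auto
  have "concat (map ?f [n..<N]) = Action a # concat (map ?g [n..<N])"
    unfolding upt list.map concat.simps head tail by simp
  with 3 show ?case by simp
qed

text \<open>Built backwards from the last phase. Consecutive thread sets may coincide although
  \<open>sync_on\<close> descends strictly; \<open>sync_on_mono\<close> absorbs both cases.\<close>

lemma sync_on_concat:
  assumes T: "\<And>k. finite (T k)" "\<And>k. T (Suc k) \<subseteq> T k"
    and blk: "\<And>k. blk k \<in> lists (Act \<times> T k)" and "k \<le> M"
  shows "sync_on (T k) (blk k @ concat (map (\<lambda>k. sync_word (T k) @ blk k) [Suc k..<Suc M]))"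
  using \<open>k \<le> M\<close>
proof (induction k rule: inc_induct)
  case base
  have "sync_on (T M) []" by (rule sync_on_mono[OF sync_empty]) (auto simp: T)
  from sync_on_prepend[OF this disjI1[OF blk]] show ?case by simp
next
  case (step n)
  have "sync_on (T n) (sync_word (T (Suc n)) @ blk (Suc n) @
      concat (map (\<lambda>k. sync_word (T k) @ blk k) [Suc (Suc n)..<Suc M]))"
    by (rule sync_on_mono[OF sync_on_prepend[OF step.IH] T(2)]) (auto simp: T)
  moreover have "[Suc n..<Suc M] = Suc n # [Suc (Suc n)..<Suc M]"
    using step by (simp add: upt_conv_Cons)
  ultimately show ?case using sync_on_prepend[OF _ disjI1[OF blk[of n]]] by simp
qed

lemma filter_less_Suc:
  fixes f :: "'b \<Rightarrow> nat"
  assumes "sorted (map f xs)"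
  shows "filter (\<lambda>x. f x < Suc n) xs = filter (\<lambda>x. f x < n) xs @ filter (\<lambda>x. f x = n) xs"
  using assms
proof (induction xs)
  case (Cons x xs)
  show ?case
  proof (cases "f x < n")
    case False
    then have "filter (\<lambda>x. f x < n) xs = []"
      using Cons.prems by (auto simp: filter_empty_conv)
    then show ?thesis using Cons False by auto
  qed (use Cons in auto)
qed simp

text \<open>This is bucket sort: by stability, each bucket is the same before and after
  sorting.\<close>

lemma sort_key_concat_filter:
  fixes f :: "'b \<Rightarrow> nat"
  assumes "\<And>x. x \<in> set xs \<Longrightarrow> f x < N"
  shows "concat (map (\<lambda>k. filter (\<lambda>x. f x = k) xs) [0..<N]) = sort_key f xs"
proof -
  have "concat (map (\<lambda>k. filter (\<lambda>x. f x = k) (sort_key f xs)) [0..<N]) =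
      filter (\<lambda>x. f x < N) (sort_key f xs)" for N
    by (induction N) (simp_all add: filter_less_Suc)
  moreover have "filter (\<lambda>x. f x < N) (sort_key f xs) = sort_key f xs"
    using assms by (simp add: filter_id_conv)
  ultimately show ?thesis by (simp add: sort_key_stable)
qed

lemma thread_phases_filter:
  "thread_phases i (filter (\<lambda>x. snd x = k) \<sigma>) = filter (\<lambda>x. snd x = k) (thread_phases i \<sigma>)"
  by (induction \<sigma>) auto

lemma in_thread_phases: "((a, i), k) \<in> set \<sigma> \<Longrightarrow> (a, k) \<in> set (thread_phases i \<sigma>)"
  by (force simp: thread_phases_def)

lemma thread_word_concat: "thread_word i (concat xss) = concat (map (thread_word i) xss)"
  by (induction xss) auto

lemma restrict_word_concat: "restrict_word Z (concat xss) = concat (map (restrict_word Z) xss)"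
  by (induction xss) auto

lemma restrict_word_id: "set \<tau> \<subseteq> Z \<Longrightarrow> restrict_word Z \<tau> = \<tau>"
  by (induction \<tau>) auto

lemma thread_word_restrict:
  "thread_word i (restrict_word (Idx Act) \<tau>) = restrict_word Act (thread_word i \<tau>)"
  by (induction \<tau>) auto

text \<open>The reordering target is \<open>\<sigma>\<close> stably sorted by phase, with a sync-point of all threads
  that have at least \<open>k\<close> bullets inserted before phase \<open>k\<close>.\<close>

lemma ex_sync_word:
  fixes w :: "nat \<Rightarrow> 'a label list"
  assumes fin: "finite {i. w i \<noteq> []}" and \<sigma>: "\<And>i. thread_phases i \<sigma> = phases 0 (w i)"
  shows "\<exists>\<tau>. sync \<tau> \<and> (\<forall>i. thread_word i \<tau> = w i) \<and>
    restrict_word (Idx Act) \<tau> = map fst (sort_key snd \<sigma>)"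
proof -
  \<comment> \<open>Idle threads have zero bullets and would make \<open>T 0\<close> infinite, hence
    the condition \<open>w i \<noteq> []\<close>.\<close>
  define T where "T k = {i. w i \<noteq> [] \<and> k \<le> bullets (w i)}" for k
  define blk where "blk k = map fst (filter (\<lambda>x. snd x = k) \<sigma>)" for k
  have "finite ((\<lambda>i. bullets (w i)) ` {i. w i \<noteq> []})" using fin by simp
  then obtain M where "\<And>i. w i \<noteq> [] \<Longrightarrow> bullets (w i) \<le> M"
    by (auto simp: finite_nat_set_iff_bounded_le)
  then have M: "bullets (w i) \<le> M" for i by (cases "w i = []") auto
  have mem: "a \<in> Act" "k \<le> bullets (w i)" "w i \<noteq> []" if "((a, i), k) \<in> set \<sigma>" for a i k
  proof -
    have *: "(a, k) \<in> set (phases 0 (w i))" using in_thread_phases[OF that] \<sigma> by simp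
    show "a \<in> Act" using * by (auto simp: in_phases_iff)
    show "k \<le> bullets (w i)" using phases_upper[OF *] by simp
    show "w i \<noteq> []" using * by auto
  qed
  have T: "finite (T k)" "T (Suc k) \<subseteq> T k" for k
    using fin by (auto simp: T_def)
  have blk: "blk k \<in> lists (Act \<times> T k)" for k
  proof -
    have "x \<in> Act \<times> T k" if "(x, k) \<in> set \<sigma>" for x
      using mem[of "fst x" "snd x" k] that by (simp add: T_def mem_Times_iff)
    then show ?thesis by (auto simp: blk_def lists_eq_set)
  qed
  define piece where "piece k = (if k = 0 then [] else sync_word (T k)) @ blk k" for k
  define \<tau> where "\<tau> = concat (map piece [0..<Suc M])"
  have "map piece [Suc 0..<Suc M] = map (\<lambda>k. sync_word (T k) @ blk k) [Suc 0..<Suc M]"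
    by (rule map_cong) (auto simp: piece_def)
  moreover have "[0..<Suc M] = 0 # [Suc 0..<Suc M]"
    by (rule upt_conv_Cons) simp
  ultimately have "\<tau> = blk 0 @ concat (map (\<lambda>k. sync_word (T k) @ blk k) [Suc 0..<Suc M])"
    by (simp only: \<tau>_def list.map concat.simps) (simp add: piece_def)
  moreover have "sync_on (T 0) (blk 0 @ concat (map (\<lambda>k. sync_word (T k) @ blk k) [Suc 0..<Suc M]))"
    by (rule sync_on_concat[of T blk 0 M, OF T blk]) simp
  ultimately have "sync \<tau>" using T(1) unfolding sync_def by metis
  moreover have "thread_word i \<tau> = w i" for i
  proof -
    have "thread_word i (piece k) = (if 0 < k \<and> k \<le> 0 + bullets (w i) then [Bullet] else []) @
        map fst (filter (\<lambda>x. snd x = k) (phases 0 (w i)))" for k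
      by (auto simp: piece_def blk_def thread_word_sync_word T thread_word_map_fst
        thread_phases_filter \<sigma>) (auto simp: T_def)
    then have "thread_word i \<tau> = concat (map (\<lambda>k. (if 0 < k \<and> k \<le> 0 + bullets (w i) then [Bullet] else []) @
        map fst (filter (\<lambda>x. snd x = k) (phases 0 (w i)))) [0..<Suc M])"
      unfolding \<tau>_def thread_word_concat map_map comp_def by presburger
    also have "\<dots> = w i" by (rule word_eq_phases) (use M[of i] in simp)
    finally show ?thesis .
  qed
  moreover have "restrict_word (Idx Act) \<tau> = map fst (sort_key snd \<sigma>)"
  proof -
    have "restrict_word (Idx Act) (blk k) = blk k" for k
      by (rule restrict_word_id) (use blk[of k] in \<open>auto simp: lists_eq_set Idx_def\<close>)
    then have "restrict_word (Idx Act) (piece k) = blk k" for k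
      by (simp add: piece_def)
    then have "restrict_word (Idx Act) \<tau> = map fst (concat (map (\<lambda>k. filter (\<lambda>x. snd x = k) \<sigma>) [0..<Suc M]))"
      unfolding \<tau>_def restrict_word_concat map_map comp_def map_concat blk_def by presburger
    also have "concat (map (\<lambda>k. filter (\<lambda>x. snd x = k) \<sigma>) [0..<Suc M]) = sort_key snd \<sigma>"
    proof (rule sort_key_concat_filter)
      fix x assume "x \<in> set \<sigma>"
      then have "snd x \<le> bullets (w (snd (fst x)))"
        using mem(2)[of "fst (fst x)" "snd (fst x)" "snd x"] by simp
      with M show "snd x < Suc M" by (simp add: less_Suc_eq_le) (rule le_trans)
    qed
    finally show ?thesis .
  qed
  ultimately show ?thesis by blast
qed

text \<open>Supplies the distinctness of threads that a swap demands: two letters out of phase order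
  never belong to the same thread.\<close>

lemma sorted_wrt_thread_phases:
  assumes "\<And>i. sorted (map snd (thread_phases i \<sigma>))"
  shows "sorted_wrt (\<lambda>x y. snd (fst x) = snd (fst y) \<longrightarrow> snd x \<le> snd y) \<sigma>"
  using assms
proof (induction \<sigma>)
  case (Cons x \<sigma>)
  obtain a i k where x: "x = ((a, i), k)" by (metis prod.collapse)
  have "sorted (map snd (thread_phases j \<sigma>))" for j
    using Cons.prems[of j] x by (auto split: if_splits)
  moreover have "k \<le> l" if "((b, i), l) \<in> set \<sigma>" for b l
    using Cons.prems[of i] in_thread_phases[OF that] x by auto
  ultimately show ?case using Cons.IH x by auto
qed simp

section \<open>Soundness in terms of phases\<close>

locale instrumented =
  fixes G :: "('l, 'a label) cfg" and G' :: "('m, 'a label) cfg"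
  assumes G: "control_flow_graph Act G" and G': "sync_instrumentation G G'"
begin

text \<open>Distinct initial and exit locations separate a thread that has run from one that never
  started.\<close>

lemma Nil_notin_traces: "[] \<notin> traces G"
proof
  assume "[] \<in> traces G"
  then have "path G (init G) [] (exit G)" by (simp add: traces_def)
  then have "init G = exit G" by cases auto
  with G show False by (simp add: control_flow_graph_def)
qed

lemma traces_eq: "traces G = restrict_word Act ` traces G'"
  using G' by (simp add: sync_instrumentation_def)

lemma restrict_traces_nonempty: "w \<in> traces G' \<Longrightarrow> restrict_word Act w \<noteq> []"
  using Nil_notin_traces traces_eq by (metis imageI)

lemma restrict_traces_inj:
  assumes "w \<in> traces G' \<union> {[]}" "w' \<in> traces G' \<union> {[]}" "restrict_word Act w = restrict_word Act w'"
  shows "w = w'"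
proof -
  have "restrict_word Act [] = []" by simp
  with assms consider "w = []" "w' = []" | "w \<in> traces G'" "w' \<in> traces G'"
    using restrict_traces_nonempty by (metis UnE singletonD)
  then show ?thesis using assms(3) G' by cases (simp_all add: sync_instrumentation_def)
qed

lemma sound_if:
  assumes I: "\<And>w1 w2 a b k l. w1 \<in> traces G' \<Longrightarrow> w2 \<in> traces G' \<Longrightarrow> (a, k) \<in> set (phases 0 w1) \<Longrightarrow>
    (b, l) \<in> set (phases 0 w2) \<Longrightarrow> l < k \<Longrightarrow> (a, b) \<in> I"
  shows "sound_instrumentation G I G'"
  unfolding sound_instrumentation_def mazurkiewicz_reduction_def
proof (intro conjI subsetI ballI)
  fix \<tau> assume "\<tau> \<in> instrumented_interleavings G'"
  then obtain \<tau>' where \<tau>: "\<tau> = restrict_word (Idx Act) \<tau>'"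
    and \<tau>': "\<And>i. thread_word i \<tau>' \<in> traces G' \<union> {[]}"
    by (auto simp: instrumented_interleavings_def)
  have "thread_word i \<tau> \<in> traces G \<union> {[]}" for i
    using \<tau>'[of i] by (auto simp: \<tau> thread_word_restrict traces_eq)
  then show "\<tau> \<in> interleavings G"
    by (auto simp: interleavings_def \<tau> restrict_word_def)
next
  fix \<tau> assume \<tau>: "\<tau> \<in> interleavings G"
  have "\<exists>w \<in> traces G' \<union> {[]}. restrict_word Act w = thread_word i \<tau>" for i
  proof -
    have "thread_word i \<tau> \<in> traces G \<union> {[]}" using \<tau> by (simp add: interleavings_def)
    then show ?thesis unfolding traces_eq by auto
  qed
  then obtain w where w: "\<And>i. w i \<in> traces G' \<union> {[]}" "\<And>i. restrict_word Act (w i) = thread_word i \<tau>"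
    by metis
  have "thread_word i \<tau> = map fst (phases 0 (w i))" for i
    by (simp add: map_fst_phases w)
  then obtain \<sigma> where \<sigma>: "map fst \<sigma> = \<tau>" "\<And>i. thread_phases i \<sigma> = phases 0 (w i)"
    using ex_phased[of \<tau> "\<lambda>i. phases 0 (w i)"] by blast
  \<comment> \<open>A thread that is not idle performs at least one action, so it occurs in \<tau>;
    this makes the set of active threads finite.\<close>
  have "i \<in> snd ` set \<tau>" if "w i \<noteq> []" for i
  proof -
    have "thread_word i \<tau> \<noteq> []" using w(1)[of i] w(2)[of i] that restrict_traces_nonempty by fastforce
    then show ?thesis by (force simp: thread_word_def filter_empty_conv)
  qed
  then have "{i. w i \<noteq> []} \<subseteq> snd ` set \<tau>" by (intro subsetI) simp
  then have "finite {i. w i \<noteq> []}" by (rule finite_subset) simp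
  from ex_sync_word[OF this \<sigma>(2)] obtain \<tau>' where \<tau>': "sync \<tau>'" "\<And>i. thread_word i \<tau>' = w i"
    "restrict_word (Idx Act) \<tau>' = map fst (sort_key snd \<sigma>)" by blast
  have "\<tau>' \<in> lists (Idx (Act \<union> {Bullet}))"
    unfolding Act_Un_Bullet by (auto simp: lists_eq_set Idx_def)
  then have "map fst (sort_key snd \<sigma>) \<in> instrumented_interleavings G'"
    unfolding instrumented_interleavings_def using \<tau>' w(1)
    by (intro image_eqI[of _ _ \<tau>']) simp_all
  moreover have "swap_order I (map fst \<sigma>) (map fst (sort_key snd \<sigma>))"
  proof (rule swap_order_sort)
    have "set (map fst \<sigma>) \<subseteq> Idx Act"
      unfolding \<sigma>(1) using \<tau> by (auto simp: interleavings_def)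
    then show "fst ` set \<sigma> \<subseteq> Idx Act" by simp
    have sorted: "sorted_wrt (\<lambda>x y. snd (fst x) = snd (fst y) \<longrightarrow> snd x \<le> snd y) \<sigma>"
      by (rule sorted_wrt_thread_phases) (simp add: \<sigma> sorted_phases)
    have "(fst (fst x), fst (fst y)) \<in> I" if xy: "x \<in> set \<sigma>" "y \<in> set \<sigma>" "snd y < snd x" for x y
    proof -
      obtain a i k where x: "x = ((a, i), k)" by (metis prod.collapse)
      obtain b j l where y: "y = ((b, j), l)" by (metis prod.collapse)
      have "(a, k) \<in> set (phases 0 (w i))" "(b, l) \<in> set (phases 0 (w j))"
        using xy(1,2)[unfolded x y, THEN in_thread_phases] by (simp_all add: \<sigma>(2))
      moreover from this have "w i \<in> traces G'" "w j \<in> traces G'" using w(1)[of i] w(1)[of j] by auto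
      ultimately show ?thesis using I[of "w i" "w j" a k b l] xy(3) x y by simp
    qed
    note unordered = this
    show "sorted_wrt (\<lambda>x y. snd y < snd x \<longrightarrow>
        (fst (fst x), fst (fst y)) \<in> I \<and> snd (fst x) \<noteq> snd (fst y)) \<sigma>"
    proof (rule sorted_wrt_mono_rel[OF _ sorted])
      fix x y assume "x \<in> set \<sigma>" "y \<in> set \<sigma>" "snd (fst x) = snd (fst y) \<longrightarrow> snd x \<le> snd y"
      then show "snd y < snd x \<longrightarrow> (fst (fst x), fst (fst y)) \<in> I \<and> snd (fst x) \<noteq> snd (fst y)"
        using unordered[of x y] by linarith
    qed
  qed
  ultimately show "\<exists>\<tau>'\<in>instrumented_interleavings G'. swap_order I \<tau> \<tau>'"
    unfolding \<sigma>(1) by (rule bexI[rotated])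
qed

lemma sound_onlyif:
  assumes sound: "sound_instrumentation G I G'"
    and w: "w1 \<in> traces G'" "w2 \<in> traces G'"
    and ab: "(a, k) \<in> set (phases 0 w1)" "(b, l) \<in> set (phases 0 w2)" "l < k"
  shows "(a, b) \<in> I"
proof (rule ccontr)
  assume nI: "(a, b) \<notin> I"
  define w where "w = (\<lambda>i::nat. if i = 0 then w1 else if i = 1 then w2 else [])"
  define \<sigma> where "\<sigma> = map (\<lambda>(a, k). ((a, 0::nat), k)) (phases 0 w1) @
    map (\<lambda>(a, k). ((a, 1), k)) (phases 0 w2)"
  have tp: "thread_phases i (map (\<lambda>(a, k). ((a, j), k)) xs) = (if i = j then xs else [])"
    for i j and xs :: "('a label \<times> nat) list"
    by (induction xs) auto
  have \<sigma>: "thread_phases i \<sigma> = phases 0 (w i)" for i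
    by (auto simp: \<sigma>_def w_def tp)
  have wi: "w i \<in> traces G' \<union> {[]}" for i using w by (auto simp: w_def)
  have tw: "thread_word i (map fst \<sigma>) = restrict_word Act (w i)" for i
    by (simp add: thread_word_map_fst \<sigma> map_fst_phases)
  have "map fst \<sigma> \<in> interleavings G"
  proof -
    have "fst ` set \<sigma> \<subseteq> Idx Act" by (auto simp: \<sigma>_def in_phases_iff)
    moreover have "restrict_word Act (w i) \<in> traces G \<union> {[]}" for i
      using wi[of i] by (auto simp: traces_eq)
    ultimately show ?thesis by (auto simp: interleavings_def tw)
  qed
  then obtain \<tau> where \<tau>: "swap_order I (map fst \<sigma>) (restrict_word (Idx Act) \<tau>)" "sync \<tau>"
    "\<And>i. thread_word i \<tau> \<in> traces G' \<union> {[]}"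
    using sound by (auto simp: sound_instrumentation_def mazurkiewicz_reduction_def
      instrumented_interleavings_def)
  let ?P = "sorted_wrt (\<lambda>u v. \<not> (u = ((a, 0), k) \<and> v = ((b, 1), l)))"
  obtain \<sigma>' where \<sigma>': "map fst \<sigma>' = restrict_word (Idx Act) \<tau>"
    "\<And>i. thread_phases i \<sigma>' = thread_phases i \<sigma>" "\<not> ?P \<sigma> \<Longrightarrow> \<not> ?P \<sigma>'"
    using swap_order_lift[OF \<tau>(1) refl] nI by fastforce
  have "\<not> ?P \<sigma>"
    using ab by (force simp: \<sigma>_def sorted_wrt_append)
  \<comment> \<open>Swaps preserve the trace of each thread, and injectivity forces its instrumented
    version to be \<open>w i\<close>; so the phases in the target are the original ones.\<close>
  have "restrict_word Act (thread_word i \<tau>) = restrict_word Act (w i)" for i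
    using arg_cong[OF \<sigma>'(1), of "thread_word i"]
    unfolding thread_word_map_fst \<sigma>'(2) \<sigma> thread_word_restrict map_fst_phases by (rule sym)
  then have "thread_word i \<tau> = w i" for i
    by (rule restrict_traces_inj[OF \<tau>(3) wi])
  then have "phase_word (\<lambda>_. 0) \<tau> = \<sigma>'"
    by (intro phased_unique) (simp_all add: map_fst_phase_word thread_phases_phase_word \<sigma>' \<sigma>)
  moreover obtain T where "sync_on T \<tau>" using \<tau>(2) by (auto simp: sync_def)
  ultimately have "sorted (map snd \<sigma>')"
    using sync_on_sorted[of T \<tau> "\<lambda>_. 0" 0] by simp
  then have "sorted_wrt (\<lambda>u v. snd u \<le> snd v) \<sigma>'" by (simp add: sorted_map)
  then have "?P \<sigma>'" by (rule sorted_wrt_mono_rel[rotated]) (use ab(3) in auto)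
  with \<sigma>'(3) \<open>\<not> ?P \<sigma>\<close> show False by blast
qed

end

section \<open>Soundness as reachability\<close>

lemma path_append: "path G l u l' \<Longrightarrow> path G l' v l'' \<Longrightarrow> path G l (u @ v) l''"
  by (induction rule: path.induct) (auto intro: path.intros)

lemma path_appendE:
  assumes "path G l (u @ v) l''" "l \<in> locs G" "trans G \<subseteq> locs G \<times> A \<times> locs G"
  obtains l' where "path G l u l'" "path G l' v l''"
  using assms(1,2)
proof (induction u arbitrary: l thesis)
  case Nil
  then show ?case by (auto intro: path_Nil)
next
  case (Cons a u)
  from Cons.prems(2) obtain m where m: "(l, a, m) \<in> trans G" "path G m (u @ v) l''"
    by (auto elim: path.cases)
  moreover have "m \<in> locs G" using m assms(3) by blast
  ultimately obtain l' where "path G m u l'" "path G l' v l''" using Cons.IH by metis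
  with m(1) show ?case using Cons.prems(1) by (blast intro: path_Cons)
qed

lemma path_locs:
  assumes "path G l w l'" "trans G \<subseteq> locs G \<times> A \<times> locs G"
  shows "l \<in> locs G" "l' \<in> locs G"
proof -
  have "l \<in> locs G \<and> l' \<in> locs G"
    using assms(1) by (induction rule: path.induct) (use assms(2) in auto)
  then show "l \<in> locs G" "l' \<in> locs G" by auto
qed

definition edges :: "('l, 'b) cfg \<Rightarrow> ('l \<times> 'l) set" where
  "edges G = {(l, l'). \<exists>a. (l, a, l') \<in> trans G}"

lemma path_iff_edges:
  assumes "trans G \<subseteq> locs G \<times> A \<times> locs G" "l \<in> locs G"
  shows "(\<exists>w. path G l w l') \<longleftrightarrow> (l, l') \<in> (edges G)\<^sup>*"
proof
  assume "\<exists>w. path G l w l'"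
  then obtain w where "path G l w l'" by blast
  then show "(l, l') \<in> (edges G)\<^sup>*"
    by (induction rule: path.induct) (auto simp: edges_def intro: converse_rtrancl_into_rtrancl)
next
  assume "(l, l') \<in> (edges G)\<^sup>*"
  then show "\<exists>w. path G l w l'"
  proof (induction rule: converse_rtrancl_induct)
    case base
    have "l' \<in> locs G" using \<open>(l, l') \<in> (edges G)\<^sup>*\<close>
      by (induction rule: rtrancl_induct) (use assms in \<open>auto simp: edges_def\<close>)
    then show ?case by (blast intro: path_Nil)
  next
    case (step y z)
    then show ?case by (auto simp: edges_def intro: path_Cons)
  qed
qed

text \<open>Pairs of locations connected by this relation are reached on two paths with equally
  many sync-points: sync-points are passed simultaneously, other edges independently.\<close>

inductive_set sync_edges :: "('l, 'a label) cfg \<Rightarrow> (('l \<times> 'l) \<times> ('l \<times> 'l)) set" for G where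
  sync_edges_left: "(l, a, l') \<in> trans G \<Longrightarrow> a \<noteq> Bullet \<Longrightarrow> q \<in> locs G \<Longrightarrow> ((l, q), (l', q)) \<in> sync_edges G"
| sync_edges_right: "(l, a, l') \<in> trans G \<Longrightarrow> a \<noteq> Bullet \<Longrightarrow> q \<in> locs G \<Longrightarrow> ((q, l), (q, l')) \<in> sync_edges G"
| sync_edges_both: "(l, Bullet, l') \<in> trans G \<Longrightarrow> (r, Bullet, r') \<in> trans G \<Longrightarrow>
    ((l, r), (l', r')) \<in> sync_edges G"

lemma sync_edgesE:
  assumes "e \<in> sync_edges G"
  obtains (left) l a l' q where "e = ((l, q), (l', q))" "(l, a, l') \<in> trans G" "a \<noteq> Bullet" "q \<in> locs G"
  | (right) l a l' q where "e = ((q, l), (q, l'))" "(l, a, l') \<in> trans G" "a \<noteq> Bullet" "q \<in> locs G"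
  | (both) l l' r r' where "e = ((l, r), (l', r'))" "(l, Bullet, l') \<in> trans G" "(r, Bullet, r') \<in> trans G"
proof -
  obtain p q p' q' where "e = ((p, q), (p', q'))" by (metis prod.collapse)
  with assms show thesis using that by (auto elim!: sync_edges.cases)
qed

text \<open>Whenever one of the words starts with an action, that path advances alone; two leading
  bullets are passed together. A bullet facing an empty word would contradict the equal counts, so
  the cases are exhaustive.\<close>

lemma sync_edges_if_paths:
  assumes tr: "trans G \<subseteq> locs G \<times> A \<times> locs G"
    and "path G p u p'" "path G q v q'" "bullets u = bullets v"
  shows "((p, q), (p', q')) \<in> (sync_edges G)\<^sup>*"
  using assms(2-4)
proof (induction "length u + length v" arbitrary: p q u v rule: less_induct)
  case less
  note locs = path_locs[OF less.prems(1) tr] path_locs[OF less.prems(2) tr]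
  consider (left) a u' where "u = a # u'" "a \<noteq> Bullet" | (right) a v' where "v = a # v'" "a \<noteq> Bullet"
    | (both) u' v' where "u = Bullet # u'" "v = Bullet # v'" | (Nil) "u = []" "v = []"
    using less.prems(3) by (cases u; cases v) (auto split: if_splits)
  then show ?case
  proof cases
    case left
    then obtain m where m: "(p, a, m) \<in> trans G" "path G m u' p'"
      using less.prems(1) by (auto elim: path.cases)
    have "((m, q), (p', q')) \<in> (sync_edges G)\<^sup>*"
      by (rule less.hyps[OF _ m(2) less.prems(2)]) (use left less.prems(3) in auto)
    then show ?thesis
      using sync_edges_left[OF m(1) left(2) locs(3)] by (rule converse_rtrancl_into_rtrancl[rotated])
  next
    case right
    then obtain m where m: "(q, a, m) \<in> trans G" "path G m v' q'"
      using less.prems(2) by (auto elim: path.cases)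
    have "((p, m), (p', q')) \<in> (sync_edges G)\<^sup>*"
      by (rule less.hyps[OF _ less.prems(1) m(2)]) (use right less.prems(3) in auto)
    then show ?thesis
      using sync_edges_right[OF m(1) right(2) locs(1)] by (rule converse_rtrancl_into_rtrancl[rotated])
  next
    case both
    then obtain m where m: "(p, Bullet, m) \<in> trans G" "path G m u' p'"
      using less.prems(1) by (auto elim: path.cases)
    obtain n where n: "(q, Bullet, n) \<in> trans G" "path G n v' q'"
      using both less.prems(2) by (auto elim: path.cases)
    have "((m, n), (p', q')) \<in> (sync_edges G)\<^sup>*"
      by (rule less.hyps[OF _ m(2) n(2)]) (use both less.prems(3) in auto)
    then show ?thesis
      using sync_edges_both[OF m(1) n(1)] by (rule converse_rtrancl_into_rtrancl[rotated])
  next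
    case Nil
    then have "p' = p" "q' = q" using less.prems(1,2) by (auto elim: path.cases)
    then show ?thesis by simp
  qed
qed

lemma paths_if_sync_edges:
  assumes tr: "trans G \<subseteq> locs G \<times> A \<times> locs G" and "p \<in> locs G" "q \<in> locs G"
    and "((p, q), z) \<in> (sync_edges G)\<^sup>*"
  shows "\<exists>u v. path G p u (fst z) \<and> path G q v (snd z) \<and> bullets u = bullets v"
  using assms(4)
proof (induction rule: rtrancl_induct)
  case base
  then show ?case using assms(2,3) by (auto intro!: exI[of _ "[]"] path_Nil)
next
  case (step y z)
  obtain u v where uv: "path G p u (fst y)" "path G q v (snd y)" "bullets u = bullets v"
    using step.IH by blast
  have edge: "path G l [a] l'" if "(l, a, l') \<in> trans G" for l a l'
    using that tr by (intro path_Cons[OF that] path_Nil) auto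
  from step.hyps(2) show ?case
  proof (cases rule: sync_edgesE)
    case (left l a l' r)
    then have "path G p (u @ [a]) (fst z)" "path G q v (snd z)" "bullets (u @ [a]) = bullets v"
      using path_append[OF uv(1) edge[of _ a l']] uv(2,3) by auto
    then show ?thesis by blast
  next
    case (right l a l' r)
    then have "path G p u (fst z)" "path G q (v @ [a]) (snd z)" "bullets u = bullets (v @ [a])"
      using path_append[OF uv(2) edge[of _ a l']] uv(1,3) by auto
    then show ?thesis by blast
  next
    case (both l l' r r')
    then have "path G p (u @ [Bullet]) (fst z)" "path G q (v @ [Bullet]) (snd z)"
      "bullets (u @ [Bullet]) = bullets (v @ [Bullet])"
      using path_append[OF uv(1) edge[of _ Bullet l']] path_append[OF uv(2) edge[of _ Bullet r']] uv(3)
      by auto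
    then show ?thesis by blast
  qed
qed

text \<open>At \<open>z\<close> the first path is about to take the sync-point \<open>e\<close> and
  the second one to read \<open>g\<close>, after equally many sync-points. From the target of
  \<open>e\<close> any path may lead to the edge \<open>f\<close>. Bounded quantifiers and
  projections let the formula carry over literally to trees.\<close>

definition violation :: "('a label \<times> 'a label) set \<Rightarrow> ('l, 'a label) cfg \<Rightarrow> bool" where
  "violation I G \<longleftrightarrow> (\<exists>z\<in>(sync_edges G)\<^sup>* `` {(init G, init G)}. \<exists>e\<in>trans G.
     fst (snd e) = Bullet \<and> fst e = fst z \<and>
     (\<exists>l\<in>(edges G)\<^sup>* `` {snd (snd e)}. \<exists>f\<in>trans G. \<exists>g\<in>trans G.
        fst f = l \<and> fst g = snd z \<and> fst (snd f) \<noteq> Bullet \<and> fst (snd g) \<noteq> Bullet \<and>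
        (fst (snd f), fst (snd g)) \<notin> I))"

text \<open>Cuts the path right before the bullet that puts it ahead, so the prefix has as many
  bullets as the other path.\<close>

lemma more_bullets_split:
  "m < bullets u \<Longrightarrow> \<exists>v v'. u = v @ Bullet # v' \<and> bullets v = m"
proof (induction u arbitrary: m)
  case (Cons x u)
  show ?case
  proof (cases "x = Bullet \<and> m = 0")
    case True
    then have "x # u = [] @ Bullet # u \<and> bullets [] = m" by simp
    then show ?thesis by blast
  next
    case False
    then have "m - (if x = Bullet then 1 else 0) < bullets u" using Cons.prems by auto
    from Cons.IH[OF this] obtain v v' where "u = v @ Bullet # v'"
      "bullets v = m - (if x = Bullet then 1 else 0)" by blast
    with False have "x # u = (x # v) @ Bullet # v' \<and> bullets (x # v) = m" by auto
    then show ?thesis by blast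
  qed
qed simp

lemma neq_Bullet_iff: "a \<noteq> Bullet \<longleftrightarrow> a \<in> Act"
  by (cases a) auto

context instrumented
begin

lemma cfg': "trans G' \<subseteq> locs G' \<times> UNIV \<times> locs G'" "init G' \<in> locs G'"
  "l \<in> locs G' \<Longrightarrow> \<exists>w. path G' l w (exit G')"
  using G' by (auto simp: sync_instrumentation_def control_flow_graph_def)

text \<open>The phase depends only on the prefix, and since the exit is reachable from everywhere,
  each path that reads \<open>a\<close> extends to a trace.\<close>

lemma occurrence_iff:
  "(\<exists>w\<in>traces G'. (a, k) \<in> set (phases 0 w)) \<longleftrightarrow>
    a \<noteq> Bullet \<and> (\<exists>u l l'. path G' (init G') u l \<and> (l, a, l') \<in> trans G' \<and> bullets u = k)"
  (is "?lhs \<longleftrightarrow> ?rhs")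
proof
  assume ?lhs
  then obtain u v where *: "a \<in> Act" "path G' (init G') (u @ a # v) (exit G')" "k = bullets u"
    by (auto simp: in_phases_iff traces_def)
  obtain l where l: "path G' (init G') u l" "path G' l (a # v) (exit G')"
    using path_appendE[OF *(2) cfg'(2,1)] .
  from l(2) obtain l' where "(l, a, l') \<in> trans G'" by (auto elim: path.cases)
  then show ?rhs using * l(1) unfolding neq_Bullet_iff by blast
next
  assume ?rhs
  then obtain u l l' where *: "a \<in> Act" "path G' (init G') u l" "(l, a, l') \<in> trans G'" "bullets u = k"
    by (auto simp: neq_Bullet_iff)
  then obtain v where "path G' l' v (exit G')" using cfg'(1,3) by blast
  then have "u @ a # v \<in> traces G'"
    using * by (auto simp: traces_def intro: path_append path_Cons)
  with * show ?lhs by (auto simp: in_phases_iff)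
qed

lemma sound_iff_no_violation: "sound_instrumentation G I G' \<longleftrightarrow> \<not> violation I G'"
proof -
  note tr = cfg'(1)
  have "violation I G' \<longleftrightarrow> (\<exists>a b k l. (\<exists>w\<in>traces G'. (a, k) \<in> set (phases 0 w)) \<and>
      (\<exists>w\<in>traces G'. (b, l) \<in> set (phases 0 w)) \<and> l < k \<and> (a, b) \<notin> I)"
    (is "_ \<longleftrightarrow> ?R")
  proof
    assume "violation I G'"
    then obtain p q p' l l1 q1 a b where *: "((init G', init G'), (p, q)) \<in> (sync_edges G')\<^sup>*"
      "(p, Bullet, p') \<in> trans G'" "(p', l) \<in> (edges G')\<^sup>*"
      "(l, a, l1) \<in> trans G'" "(q, b, q1) \<in> trans G'" "a \<noteq> Bullet" "b \<noteq> Bullet" "(a, b) \<notin> I"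
      unfolding violation_def by fastforce
    obtain u v where uv: "path G' (init G') u p" "path G' (init G') v q" "bullets u = bullets v"
      using paths_if_sync_edges[OF tr cfg'(2,2) *(1)] by auto
    have "p' \<in> locs G'" using *(2) tr by auto
    then obtain u' where "path G' p' u' l" using path_iff_edges[OF tr] *(3) by metis
    then have "path G' (init G') (u @ Bullet # u') l"
      using uv(1) *(2) by (blast intro: path_append path_Cons)
    then have "\<exists>w\<in>traces G'. (a, bullets (u @ Bullet # u')) \<in> set (phases 0 w)"
      unfolding occurrence_iff using * by blast
    moreover have "\<exists>w\<in>traces G'. (b, bullets v) \<in> set (phases 0 w)"
      unfolding occurrence_iff using * uv by blast
    moreover have "bullets v < bullets (u @ Bullet # u')" using uv by simp
    ultimately show ?R using *(8) by blast
  next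
    assume ?R
    then obtain a b u l l1 v q q1 where *: "a \<noteq> Bullet" "b \<noteq> Bullet" "path G' (init G') u l"
      "(l, a, l1) \<in> trans G'" "path G' (init G') v q" "(q, b, q1) \<in> trans G'"
      "bullets v < bullets u" "(a, b) \<notin> I"
      unfolding occurrence_iff by blast
    obtain u1 u2 where u: "u = u1 @ Bullet # u2" "bullets u1 = bullets v"
      using more_bullets_split[OF *(7)] by blast
    obtain p where p: "path G' (init G') u1 p" "path G' p (Bullet # u2) l"
      using path_appendE[OF *(3)[unfolded u(1)] cfg'(2,1)] .
    from p(2) obtain p' where p': "(p, Bullet, p') \<in> trans G'" "path G' p' u2 l"
      by (auto elim: path.cases)
    have 1: "((init G', init G'), (p, q)) \<in> (sync_edges G')\<^sup>*"
      by (rule sync_edges_if_paths[OF tr p(1) *(5) u(2)])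
    have "p' \<in> locs G'" using p'(1) tr by auto
    then have 2: "(p', l) \<in> (edges G')\<^sup>*" using path_iff_edges[OF tr] p'(2) by metis
    show "violation I G'"
      unfolding violation_def
      by (rule bexI[of _ "(p, q)"], rule bexI[OF _ p'(1)], intro conjI, simp, simp,
          rule bexI[of _ l], rule bexI[OF _ *(4)], rule bexI[OF _ *(6)]) (use 1 2 * in auto)
  qed
  then show ?thesis using sound_if[of I] sound_onlyif[of I] by blast
qed

end

section \<open>Deciding soundness on encodings\<close>

text \<open>The closure is computed on codes. By injectivity, two edges that meet in a code meet in
  a vertex, so no spurious paths arise.\<close>

lemma rtrancl_Image_inj:
  assumes "inj f"
  shows "(map_prod f f ` R)\<^sup>* `` {f x} = f ` (R\<^sup>* `` {x})"
proof -
  have "\<exists>z. y = f z \<and> (x, z) \<in> R\<^sup>*" if "(f x, y) \<in> (map_prod f f ` R)\<^sup>*" for y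
    using that
  proof (induction rule: rtrancl_induct)
    case (step y z)
    then show ?case using injD[OF assms] by (auto intro: rtrancl_into_rtrancl)
  qed blast
  moreover have "(f x, f z) \<in> (map_prod f f ` R)\<^sup>*" if "(x, z) \<in> R\<^sup>*" for z
    using that by (induction rule: rtrancl_induct) (auto intro: rtrancl_into_rtrancl)
  ultimately show ?thesis by auto
qed

lemma inj_enc_list:
  assumes "inj f"
  shows "inj (enc_list f)"
proof (rule injI)
  fix xs ys assume "enc_list f xs = enc_list f ys"
  from arg_cong[OF this, of elems] show "xs = ys"
    using assms by (simp add: inj_map_eq_map)
qed

lemma inj_bits: "inj bits"
proof (rule injI)
  fix m n show "bits m = bits n \<Longrightarrow> m = n"
  proof (induction m arbitrary: n rule: less_induct)
    case (less m)
    show ?case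
    proof (cases "m = 0 \<or> n = 0")
      case True
      then show ?thesis using less.prems by (auto simp: bits.simps[of m] bits.simps[of n] split: if_splits)
    next
      case False
      then have *: "odd m = odd n" "bits (m div 2) = bits (n div 2)"
        using less.prems by (simp_all add: bits.simps[of m] bits.simps[of n])
      have "m div 2 = n div 2" using less.IH[OF _ *(2)] False by simp
      with *(1) show ?thesis by (metis odd_two_times_div_two_succ even_two_times_div_two)
    qed
  qed
qed

lemma inj_enc_nat: "inj enc_nat"
proof -
  have "enc_nat = enc_list tree_of_bool \<circ> bits" by (auto simp: enc_nat_def)
  then show ?thesis using inj_compose[OF inj_enc_list inj_bits, of tree_of_bool] by (simp add: inj_def)
qed

lemma enc_nat_inject [simp]: "enc_nat m = enc_nat n \<longleftrightarrow> m = n"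
  using inj_enc_nat by (simp add: inj_eq)

lemma enc_label_inject [simp]: "enc_label a = enc_label b \<longleftrightarrow> a = b"
  by (cases a; cases b) auto

lemma enc_label_eq_Leaf [simp]: "enc_label a = Leaf \<longleftrightarrow> a = Bullet"
  by (cases a) auto

section \<open>The criterion on codes\<close>

definition enc_pair :: "nat \<times> nat \<Rightarrow> tree" where
  "enc_pair z = Node (enc_nat (fst z)) (enc_nat (snd z))"

lemma inj_enc_pair: "inj enc_pair"
  by (auto simp: inj_def enc_pair_def)

abbreviation "src e \<equiv> left_of e"
abbreviation "lab e \<equiv> left_of (right_of e)"
abbreviation "dst e \<equiv> right_of (right_of e)"

definition edges_tree :: "tree set \<Rightarrow> tree set" where
  "edges_tree E = (\<Union>e\<in>E. {Node (src e) (dst e)})"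

text \<open>A label equal to \<open>Leaf\<close> is a bullet. The three rules of
  \<open>sync_edges\<close> are expressed by unions, conditionals and explicit finite sets, for
  which closure rules exist.\<close>

definition sync_edges_tree :: "tree set \<Rightarrow> tree set \<Rightarrow> tree set" where
  "sync_edges_tree L E =
     (\<Union>e\<in>E. if \<not> lab e = Leaf
        then \<Union>q\<in>L. {Node (Node (src e) q) (Node (dst e) q), Node (Node q (src e)) (Node q (dst e))}
        else {}) \<union>
     (\<Union>e\<in>E. if lab e = Leaf
        then \<Union>f\<in>E. if lab f = Leaf
          then {Node (Node (src e) (src f)) (Node (dst e) (dst f))} else {}
        else {})"

definition violation_tree :: "tree \<Rightarrow> tree set \<Rightarrow> tree set \<Rightarrow> tree set \<Rightarrow> bool" where
  "violation_tree i I L E \<longleftrightarrow> (\<exists>z\<in>(graph_of (sync_edges_tree L E))\<^sup>* `` {Node i i}. \<exists>e\<in>E.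
     lab e = Leaf \<and> src e = left_of z \<and>
     (\<exists>l\<in>(graph_of (edges_tree E))\<^sup>* `` {dst e}. \<exists>f\<in>E. \<exists>g\<in>E.
        src f = l \<and> src g = right_of z \<and> \<not> lab f = Leaf \<and> \<not> lab g = Leaf \<and>
        \<not> Node (lab f) (lab g) \<in> I))"

lemma graph_of_edges_tree:
  "graph_of (edges_tree (enc_edge ` trans G)) = map_prod enc_nat enc_nat ` edges G"
proof
  show "graph_of (edges_tree (enc_edge ` trans G)) \<subseteq> map_prod enc_nat enc_nat ` edges G"
    unfolding graph_of_def edges_tree_def edges_def by force
  show "map_prod enc_nat enc_nat ` edges G \<subseteq> graph_of (edges_tree (enc_edge ` trans G))"
  proof
    fix x assume "x \<in> map_prod enc_nat enc_nat ` edges G"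
    then obtain l a l' where *: "x = (enc_nat l, enc_nat l')" "(l, a, l') \<in> trans G"
      by (auto simp: edges_def)
    have "Node (enc_nat l) (enc_nat l') \<in> edges_tree (enc_edge ` trans G)"
      unfolding edges_tree_def by (rule UN_I[OF imageI[OF *(2)]]) simp
    then show "x \<in> graph_of (edges_tree (enc_edge ` trans G))"
      unfolding graph_of_def *(1) by (rule image_eqI[rotated]) simp
  qed
qed

lemma graph_of_sync_edges_tree:
  "graph_of (sync_edges_tree (enc_nat ` locs G) (enc_edge ` trans G)) =
    map_prod enc_pair enc_pair ` sync_edges G" (is "?l = ?r")
proof
  show "?l \<subseteq> ?r"
  proof
    fix x assume "x \<in> ?l"
    then consider
      (1) l a l' q where "(l, a, l') \<in> trans G" "a \<noteq> Bullet" "q \<in> locs G"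
        "x = map_prod enc_pair enc_pair ((l, q), (l', q)) \<or> x = map_prod enc_pair enc_pair ((q, l), (q, l'))"
    | (2) l l' r r' where "(l, Bullet, l') \<in> trans G" "(r, Bullet, r') \<in> trans G"
        "x = map_prod enc_pair enc_pair ((l, r), (l', r'))"
      unfolding graph_of_def sync_edges_tree_def
      by (force split: if_splits simp: enc_pair_def)
    then show "x \<in> ?r" by cases (auto intro: sync_edges.intros)
  qed
  show "?r \<subseteq> ?l"
  proof
    fix x assume "x \<in> ?r"
    then obtain y where y: "x = map_prod enc_pair enc_pair y" "y \<in> sync_edges G"
      by (rule imageE)
    from y(2) have "\<exists>e\<in>sync_edges_tree (enc_nat ` locs G) (enc_edge ` trans G). x = (left_of e, right_of e)"
    proof (cases rule: sync_edgesE)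
      case (left l a l' q)
      have "Node (enc_pair (l, q)) (enc_pair (l', q)) \<in> sync_edges_tree (enc_nat ` locs G) (enc_edge ` trans G)"
        unfolding sync_edges_tree_def
        by (rule UnI1, rule UN_I[OF imageI[OF left(2)]]) (use left in \<open>auto simp: enc_pair_def\<close>)
      then show ?thesis by (rule bexI[rotated]) (simp add: y(1) left(1))
    next
      case (right l a l' q)
      have "Node (enc_pair (q, l)) (enc_pair (q, l')) \<in> sync_edges_tree (enc_nat ` locs G) (enc_edge ` trans G)"
        unfolding sync_edges_tree_def
        by (rule UnI1, rule UN_I[OF imageI[OF right(2)]]) (use right in \<open>auto simp: enc_pair_def\<close>)
      then show ?thesis by (rule bexI[rotated]) (simp add: y(1) right(1))
    next
      case (both l l' r r')
      have "Node (enc_pair (l, r)) (enc_pair (l', r')) \<in> sync_edges_tree (enc_nat ` locs G) (enc_edge ` trans G)"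
        unfolding sync_edges_tree_def
        by (rule UnI2, rule UN_I[OF imageI[OF both(2)]], subst if_P, simp,
          rule UN_I[OF imageI[OF both(3)]]) (simp add: enc_pair_def)
      then show ?thesis by (rule bexI[rotated]) (simp add: y(1) both(1))
    qed
    then show "x \<in> ?l" unfolding graph_of_def by blast
  qed
qed

text \<open>Both formulas have the same shape, and the closures on the left are images under
  injective encodings; hence quantifiers over codes become quantifiers over the coded
  objects.\<close>

lemma violation_tree_iff:
  "violation_tree (enc_nat (init G)) (enc_label_pair ` I) (enc_nat ` locs G) (enc_edge ` trans G) \<longleftrightarrow>
    violation I G"
proof -
  have enc [simp]: "src (enc_edge e) = enc_nat (fst e)" "lab (enc_edge e) = enc_label (fst (snd e))"
    "dst (enc_edge e) = enc_nat (snd (snd e))" for e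
    by (cases e; simp)+
  have [simp]: "left_of (enc_pair z) = enc_nat (fst z)" "right_of (enc_pair z) = enc_nat (snd z)" for z
    by (auto simp: enc_pair_def)
  have I: "Node (enc_label a) (enc_label b) \<in> enc_label_pair ` I \<longleftrightarrow> (a, b) \<in> I" for a b
    by (force simp: image_iff)
  have init: "Node (enc_nat (init G)) (enc_nat (init G)) = enc_pair (init G, init G)"
    by (simp add: enc_pair_def)
  show ?thesis
    unfolding violation_tree_def violation_def graph_of_edges_tree graph_of_sync_edges_tree init
      rtrancl_Image_inj[OF inj_enc_pair] bex_simps(7) enc rtrancl_Image_inj[OF inj_enc_nat] I
    by simp
qed

text \<open>The projections are the places of \<open>I\<close> and of \<open>init\<close>,
  \<open>locs\<close> and \<open>trans\<close> of \<open>G'\<close> in an encoded instance. After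
  unfolding, the derivation follows the syntax of the formula.\<close>

lemma ptime_violation:
  "ptime_pred (\<lambda>t. \<not> violation_tree
     (left_of (left_of (right_of (right_of t))))
     (set (elems (left_of (right_of t))))
     (set (elems (left_of (right_of (right_of (right_of t))))))
     (set (elems (right_of (right_of (right_of (right_of t)))))))"
  unfolding violation_tree_def edges_tree_def sync_edges_tree_def
  by (intro ptime_intros)

theorem theorem4p10:
  "polytime_decidable encodes_instance
     {(G :: (nat, nat label) cfg, I, G' :: (nat, nat label) cfg).
        control_flow_graph Act G \<and>
        I \<subseteq> labels G \<times> labels G \<and>
        sync_instrumentation G G'}
     (\<lambda>(G, I, G'). sound_instrumentation G I G')"
proof (rule polytime_decidableI[OF ptime_violation])
  fix x :: "(nat, nat label) cfg \<times> (nat label \<times> nat label) set \<times> (nat, nat label) cfg" and t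
  assume x: "x \<in> {(G, I, G'). control_flow_graph Act G \<and> I \<subseteq> labels G \<times> labels G \<and>
    sync_instrumentation G G'}" and t: "encodes_instance x t"
  obtain G I G' where [simp]: "x = (G, I, G')" by (cases x)
  interpret instrumented G G' by standard (use x in auto)
  obtain tG tI tl td where tt: "encodes_set enc_label_pair I tI" "encodes_set enc_nat (locs G') tl"
    "encodes_set enc_edge (trans G') td"
    "t = Node tG (Node tI (Node (Node (enc_nat (init G')) (enc_nat (exit G'))) (Node tl td)))"
    using t by (auto simp: encodes_cfg_def)
  \<comment> \<open>Every listing of a set yields the same set of elements, so the answer is the
    same for all admissible encodings.\<close>
  have "set (elems u) = f ` X" if "encodes_set f X u" for f :: "'z \<Rightarrow> tree" and X u
    using that by (auto simp: encodes_set_def)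
  note this[OF tt(1)] this[OF tt(2)] this[OF tt(3)]
  then show "\<not> violation_tree (left_of (left_of (right_of (right_of t))))
     (set (elems (left_of (right_of t))))
     (set (elems (left_of (right_of (right_of (right_of t))))))
     (set (elems (right_of (right_of (right_of (right_of t)))))) \<longleftrightarrow>
    (case x of (G, I, G') \<Rightarrow> sound_instrumentation G I G')"
    by (simp add: tt(4) violation_tree_iff sound_iff_no_violation)
qed

end
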